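(* Let $k$ be a field, $R$ a $k$-algebra, and $p\in R$ an element such that $1\notin pR+Rp$. Let $B=B_{++}\cup B_{+-}\cup B_{-+}\cup B_{--}$, where $B_{++}$ is a $k$-basis of $pR\cap Rp$ which, if $p\neq 0$, contains $p$; $B_{+-}$ is a $k$-basis of $pR$ relative to $pR\cap Rp$; $B_{-+}$ is a $k$-basis of $Rp$ relative to $pR\cap Rp$; and $B_{--}$ is a $k$-basis of $R$ relative to $pR+Rp+k$. Let $R'=R\langle q\mid pqp=p\rangle$. Let $(M,M_+)$ be a $p$-tempered right $R$-module, let $C_+$ be a $k$-basis of $M_+$, and let $C_-$ be a $k$-basis of $M$ relative to $M_+$, so that $C=C_+\cup C_-$ is a $k$-basis of $M$. Then $(M,M_+)\otimes_{(R,p)}R'$ has a $k$-basis given by all words $w$ that are composed of an element of $C$ followed by a (possibly empty) string of elements of $B\cup\{q\}$, such that $w$ contains no subwords of any of the forms (i) $xy$ with $x,y\in B$; (ii) $(xp)\,q\,(py)$ with $xp\in B_{++}\cup B_{-+}$ and $py\in B_{++}\cup B_{+-}$; (iii) $xy$ with $x\in C$ and $y\in B$; (iv) $x\,q\,(py)$ with $x\in C_+$ and $py\in B_{++}\cup B_{+-}$. The reduction to this normal form may be accomplished by the system of reductions $xy\mapsto (xy)_R$ for all $x,y\in B$; $(xp)\,q\,(py)\mapsto (xpy)_R$ for all $xp\in B_{++}\cup B_{-+}$, $py\in B_{++}\cup B_{+-}$; $xy\mapsto (xy)_M$ for $x\in C$, $y\in B$; and $x\,q\,(py)\mapsto (xy)_M$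 for $x\in C_+$, $py\in B_{++}\cup B_{+-}$.
   Context: All rings are associative with unit. If $R$ is a nonzero $k$-algebra, the $k$-subspace spanned by $1$ is identified with $k$. $R\langle q\mid pqp=p\rangle$ is the $k$-algebra obtained from $R$ by freely adjoining $q$ subject to $pqp=p$. If $U\subseteq V$ are $k$-vector spaces, a $k$-basis of $V$ relative to $U$ is a subset $B\subseteq V$ such that every element of $V$ can be written uniquely as the sum of an element of $U$ and a $k$-linear combination of elements of $B$. With the choices in the claim, $B\cup\{1\}$ is a $k$-basis of $R$. A $p$-tempered right $R$-module is a pair $(M,M_+)$ where $M$ is a right $R$-module and $M_+$ is a $k$-vector-subspace of $M$ which contains $Mp$, is annihilated by the right annihilator $\{r\in R\mid pr=0\}$ of $p$ in $R$, and is closed under multiplication by the subring $\{x\in R\mid px\in Rp\}\subseteq R$. For such a pair, $(M,M_+)\otimes_{(R,p)}R'$ denotes the quotient of the right $R'$-module $M\otimes_R R'$ by the submodule generated by all elements $xqp-x$ with $x\in M_+$. Elements of $B$ and $C$ are single letters. An element of $B_{++}\cup B_{-+}$ is written $(xp)$ with $x\in R$, and an element of $B_{++}\cup B_{+-}$ is written $(py)$ with $y\in R$; $x,y$ need not be unique, but $xpy\in R$ depends only on $xp$ and $py$, and for $x\in M_+$ the element $xy\in M$ depends only on $x$ and $py$. For an expression $f$ representing an element of $R$ (resp. of $M$), $f_R$ (resp. $f_M$) denotes the unique $k$-linear combination of elements of $B\cup\{1\}$ (resp. of $C$) giving its value. Expressions for elements of the module are $k$-linear combinations of words consisting of an element of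 $C$ followed by a string of elements of $B\cup\{q\}$. A family of such words gives a $k$-basis of the module if it maps one-to-one into the module with image a $k$-basis. A reduction $W\mapsto f$ permits replacing a subword $W$ of a word occurring in an expression by $f$. That reduction to a normal form may be accomplished by a system of reductions means that the corresponding relations hold, and that, starting from any expression, repeated application of the reductions terminates at the unique $k$-linear combination of words of the given basis representing the same module element. *)

theory Defs
  imports
    "HOL-Algebra.Algebraic_Closure_Type"
    "HOL-Algebra.QuotRing"
    "HOL-Algebra.Generated_Groups"
    "HOL-Library.Poly_Mapping"
    "HOL-Library.Sublist"
begin

text \<open>
  The field \<open>k\<close>, the algebra \<open>R\<close> and the module \<open>M\<close> are types. The ring obtained by adjoining
  \<open>q\<close> and the modules over it depend on the element \<open>p\<close> and on the structure maps, so they cannot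
  be types; they are HOL-Algebra records whose elements are cosets.
\<close>

section \<open>Algebras, modules and bases\<close>

locale k_algebra = vector_space scale
  for scale :: "'k::field \<Rightarrow> 'r::ring_1 \<Rightarrow> 'r" +
  assumes mult_scale_left: "scale a x * y = scale a (x * y)"
    and mult_scale_right: "x * scale a y = scale a (x * y)"

locale right_module =
  fixes act :: "'m::ab_group_add \<Rightarrow> 'r::ring_1 \<Rightarrow> 'm"
  assumes act_add_left: "act (m + m') r = act m r + act m' r"
    and act_add_right: "act m (r + s) = act m r + act m s"
    and act_mult: "act m (r * s) = act (act m r) s"
    and act_one: "act m 1 = m"

definition module_scale ::
  "('k \<Rightarrow> 'r::ring_1 \<Rightarrow> 'r) \<Rightarrow> ('m \<Rightarrow> 'r \<Rightarrow> 'm) \<Rightarrow> 'k \<Rightarrow> 'm \<Rightarrow> 'm" where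
  "module_scale scale act a m = act m (scale a 1)"

locale p_tempered = k_algebra scale + right_module act
  for scale :: "'k::field \<Rightarrow> 'r::ring_1 \<Rightarrow> 'r"
    and act :: "'m::ab_group_add \<Rightarrow> 'r \<Rightarrow> 'm" +
  fixes p :: 'r and Mplus :: "'m set"
  assumes Mplus_subspace: "Modules.module.subspace (module_scale scale act) Mplus"
    and Mp_subset: "act m p \<in> Mplus"
    and annihilated: "x \<in> Mplus \<Longrightarrow> p * r = 0 \<Longrightarrow> act x r = 0"
    and mult_closed: "x \<in> Mplus \<Longrightarrow> p * r \<in> {s * p | s. True} \<Longrightarrow> act x r \<in> Mplus"

definition k_basis :: "('k::field \<Rightarrow> 'v::ab_group_add \<Rightarrow> 'v) \<Rightarrow> 'v set \<Rightarrow> 'v set \<Rightarrow> bool" where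
  "k_basis scale V B \<longleftrightarrow>
     \<not> Modules.module.dependent scale B \<and> Modules.module.span scale B = V"

definition relative_basis ::
  "('k::field \<Rightarrow> 'v::ab_group_add \<Rightarrow> 'v) \<Rightarrow> 'v set \<Rightarrow> 'v set \<Rightarrow> 'v set \<Rightarrow> bool" where
  "relative_basis scale V U B \<longleftrightarrow>
     B \<subseteq> V \<and>
     (\<forall>v\<in>V. \<exists>!uf :: 'v \<times> ('v \<Rightarrow>\<^sub>0 'k).
        fst uf \<in> U \<and> Poly_Mapping.keys (snd uf) \<subseteq> B \<and>
        v = fst uf + (\<Sum>b\<in>Poly_Mapping.keys (snd uf). scale (Poly_Mapping.lookup (snd uf) b) b))"

section \<open>The algebra \<open>R\<langle>q | pqp = p\<rangle>\<close>\<close>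

text \<open>
  With lists under concatenation as an additively written monoid, the type
  \<open>'x list \<Rightarrow>\<^sub>0 'k\<close> carries the convolution product and is the free \<open>k\<close>-algebra on \<open>'x\<close>.
\<close>

instantiation list :: (type) monoid_add
begin
definition zero_list :: "'a list" where "zero_list = []"
definition plus_list :: "'a list \<Rightarrow> 'a list \<Rightarrow> 'a list" where "plus_list = append"
instance by standard (simp_all add: zero_list_def plus_list_def)
end

datatype 'r letter = Elt 'r | Q

type_synonym ('r, 'k) free = "'r letter list \<Rightarrow>\<^sub>0 'k"

definition gen :: "'r letter \<Rightarrow> ('r, 'k::field) free" where
  "gen x = Poly_Mapping.single [x] 1"

definition const :: "'k::field \<Rightarrow> ('r, 'k) free" where
  "const a = Poly_Mapping.single [] a"

definition adjoin_rels :: "('k::field \<Rightarrow> 'r::ring_1 \<Rightarrow> 'r) \<Rightarrow> 'r \<Rightarrow> ('r, 'k) free set" where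
  "adjoin_rels scale p =
     {gen (Elt (x + y)) - (gen (Elt x) + gen (Elt y)) | x y. True} \<union>
     {gen (Elt (scale a x)) - const a * gen (Elt x) | a x. True} \<union>
     {gen (Elt (x * y)) - gen (Elt x) * gen (Elt y) | x y. True} \<union>
     {gen (Elt 1) - 1} \<union>
     {gen (Elt p) * gen Q * gen (Elt p) - gen (Elt p)}"

definition adjoin_ideal :: "('k::field \<Rightarrow> 'r::ring_1 \<Rightarrow> 'r) \<Rightarrow> 'r \<Rightarrow> ('r, 'k) free set" where
  "adjoin_ideal scale p = Idl\<^bsub>ring_of_type_algebra\<^esub> (adjoin_rels scale p)"

definition adjoin :: "('k::field \<Rightarrow> 'r::ring_1 \<Rightarrow> 'r) \<Rightarrow> 'r \<Rightarrow> ('r, 'k) free set ring" where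
  "adjoin scale p = ring_of_type_algebra Quot (adjoin_ideal scale p)"

definition adjoin_class ::
  "('k::field \<Rightarrow> 'r::ring_1 \<Rightarrow> 'r) \<Rightarrow> 'r \<Rightarrow> ('r, 'k) free \<Rightarrow> ('r, 'k) free set" where
  "adjoin_class scale p f = adjoin_ideal scale p +>\<^bsub>ring_of_type_algebra\<^esub> f"

definition adjoin_letter ::
  "('k::field \<Rightarrow> 'r::ring_1 \<Rightarrow> 'r) \<Rightarrow> 'r \<Rightarrow> 'r letter \<Rightarrow> ('r, 'k) free set" where
  "adjoin_letter scale p x = adjoin_class scale p (gen x)"

section \<open>The module \<open>(M, M\<^sub>+) \<otimes> R'\<close>\<close>

text \<open>
  A right module over a ring \<open>S\<close> is stored in a module record, with \<open>s \<odot> t\<close> standing for the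
  product \<open>t s\<close>; the ring multiplication and unit of the record are not used.
\<close>

definition quotient_module :: "('s, 't) module \<Rightarrow> 't set \<Rightarrow> ('s, 't set) module" where
  "quotient_module T N =
     \<lparr>carrier = a_rcosets\<^bsub>T\<^esub> N, monoid.mult = undefined, one = undefined, zero = N, add = set_add T,
      module.smult = (\<lambda>s Y. \<Union>x\<in>Y. N +>\<^bsub>T\<^esub> (s \<odot>\<^bsub>T\<^esub> x))\<rparr>"

definition generated_submodule :: "'s ring \<Rightarrow> ('s, 't) module \<Rightarrow> 't set \<Rightarrow> 't set" where
  "generated_submodule S T Y = \<Inter>{N. submodule N S T \<and> Y \<subseteq> N}"

definition free_pairs :: "'s ring \<Rightarrow> ('s, ('m \<times> 's) \<Rightarrow>\<^sub>0 int) module" where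
  "free_pairs S =
     \<lparr>carrier = {c. Poly_Mapping.keys c \<subseteq> UNIV \<times> carrier S},
      monoid.mult = undefined, one = undefined, zero = 0, add = (+),
      module.smult = (\<lambda>s. frag_extend (\<lambda>(m, t). frag_of (m, t \<otimes>\<^bsub>S\<^esub> s)))\<rparr>"

definition tensor_rels ::
  "('m::ab_group_add \<Rightarrow> 'r \<Rightarrow> 'm) \<Rightarrow> ('r \<Rightarrow> 's) \<Rightarrow> 's ring \<Rightarrow> (('m \<times> 's) \<Rightarrow>\<^sub>0 int) set" where
  "tensor_rels act j S =
     {frag_of (m + m', s) - (frag_of (m, s) + frag_of (m', s)) | m m' s. s \<in> carrier S} \<union>
     {frag_of (m, s \<oplus>\<^bsub>S\<^esub> s') - (frag_of (m, s) + frag_of (m, s')) | m s s'.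
        s \<in> carrier S \<and> s' \<in> carrier S} \<union>
     {frag_of (act m r, s) - frag_of (m, j r \<otimes>\<^bsub>S\<^esub> s) | m r s. s \<in> carrier S}"

text \<open>The tensor product \<open>M \<otimes>\<^sub>R S\<close>, where \<open>j\<close> is the structure map from \<open>R\<close> to \<open>S\<close>.\<close>

definition tensor_subgroup ::
  "('m::ab_group_add \<Rightarrow> 'r \<Rightarrow> 'm) \<Rightarrow> ('r \<Rightarrow> 's) \<Rightarrow> 's ring \<Rightarrow> (('m \<times> 's) \<Rightarrow>\<^sub>0 int) set" where
  "tensor_subgroup act j S = generate (add_monoid (free_pairs S)) (tensor_rels act j S)"

definition tensor ::
  "('m::ab_group_add \<Rightarrow> 'r \<Rightarrow> 'm) \<Rightarrow> ('r \<Rightarrow> 's) \<Rightarrow> 's ring \<Rightarrow>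
   ('s, (('m \<times> 's) \<Rightarrow>\<^sub>0 int) set) module" where
  "tensor act j S = quotient_module (free_pairs S) (tensor_subgroup act j S)"

definition pure_tensor ::
  "('m::ab_group_add \<Rightarrow> 'r \<Rightarrow> 'm) \<Rightarrow> ('r \<Rightarrow> 's) \<Rightarrow> 's ring \<Rightarrow>
   'm \<Rightarrow> 's \<Rightarrow> (('m \<times> 's) \<Rightarrow>\<^sub>0 int) set" where
  "pure_tensor act j S m s = tensor_subgroup act j S +>\<^bsub>free_pairs S\<^esub> frag_of (m, s)"

definition extension ::
  "('k::field \<Rightarrow> 'r::ring_1 \<Rightarrow> 'r) \<Rightarrow> ('m::ab_group_add \<Rightarrow> 'r \<Rightarrow> 'm) \<Rightarrow> 'r \<Rightarrow>
   (('r, 'k) free set, (('m \<times> ('r, 'k) free set) \<Rightarrow>\<^sub>0 int) set) module" where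
  "extension scale act p =
     tensor act (\<lambda>r. adjoin_letter scale p (Elt r)) (adjoin scale p)"

definition extension_elt ::
  "('k::field \<Rightarrow> 'r::ring_1 \<Rightarrow> 'r) \<Rightarrow> ('m::ab_group_add \<Rightarrow> 'r \<Rightarrow> 'm) \<Rightarrow> 'r \<Rightarrow>
   'm \<Rightarrow> (('m \<times> ('r, 'k) free set) \<Rightarrow>\<^sub>0 int) set" where
  "extension_elt scale act p m =
     pure_tensor act (\<lambda>r. adjoin_letter scale p (Elt r)) (adjoin scale p)
       m \<one>\<^bsub>adjoin scale p\<^esub>"

text \<open>The submodule generated by the elements \<open>xqp - x\<close> with \<open>x \<in> M\<^sub>+\<close>.\<close>

definition tempered_submodule ::
  "('k::field \<Rightarrow> 'r::ring_1 \<Rightarrow> 'r) \<Rightarrow> ('m::ab_group_add \<Rightarrow> 'r \<Rightarrow> 'm) \<Rightarrow> 'r \<Rightarrow> 'm set \<Rightarrow>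
   (('m \<times> ('r, 'k) free set) \<Rightarrow>\<^sub>0 int) set set" where
  "tempered_submodule scale act p Mplus =
     (let T = extension scale act p in
      generated_submodule (adjoin scale p) T
        {adjoin_letter scale p (Elt p) \<odot>\<^bsub>T\<^esub>
           (adjoin_letter scale p Q \<odot>\<^bsub>T\<^esub> extension_elt scale act p x)
         \<ominus>\<^bsub>T\<^esub> extension_elt scale act p x | x. x \<in> Mplus})"

definition tempered_tensor ::
  "('k::field \<Rightarrow> 'r::ring_1 \<Rightarrow> 'r) \<Rightarrow> ('m::ab_group_add \<Rightarrow> 'r \<Rightarrow> 'm) \<Rightarrow> 'r \<Rightarrow> 'm set \<Rightarrow>
   (('r, 'k) free set, (('m \<times> ('r, 'k) free set) \<Rightarrow>\<^sub>0 int) set set) module" where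
  "tempered_tensor scale act p Mplus =
     quotient_module (extension scale act p) (tempered_submodule scale act p Mplus)"

definition tempered_elt ::
  "('k::field \<Rightarrow> 'r::ring_1 \<Rightarrow> 'r) \<Rightarrow> ('m::ab_group_add \<Rightarrow> 'r \<Rightarrow> 'm) \<Rightarrow> 'r \<Rightarrow> 'm set \<Rightarrow>
   'm \<Rightarrow> (('m \<times> ('r, 'k) free set) \<Rightarrow>\<^sub>0 int) set set" where
  "tempered_elt scale act p Mplus m =
     tempered_submodule scale act p Mplus
       +>\<^bsub>extension scale act p\<^esub> extension_elt scale act p m"

definition tempered_scale ::
  "('k::field \<Rightarrow> 'r::ring_1 \<Rightarrow> 'r) \<Rightarrow> ('m::ab_group_add \<Rightarrow> 'r \<Rightarrow> 'm) \<Rightarrow> 'r \<Rightarrow> 'm set \<Rightarrow> 'k \<Rightarrow>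
   (('m \<times> ('r, 'k) free set) \<Rightarrow>\<^sub>0 int) set set \<Rightarrow>
   (('m \<times> ('r, 'k) free set) \<Rightarrow>\<^sub>0 int) set set" where
  "tempered_scale scale act p Mplus a t =
     adjoin_class scale p (const a) \<odot>\<^bsub>tempered_tensor scale act p Mplus\<^esub> t"

definition tempered_basis ::
  "('k::field \<Rightarrow> 'r::ring_1 \<Rightarrow> 'r) \<Rightarrow> ('m::ab_group_add \<Rightarrow> 'r \<Rightarrow> 'm) \<Rightarrow> 'r \<Rightarrow> 'm set \<Rightarrow>
   (('m \<times> ('r, 'k) free set) \<Rightarrow>\<^sub>0 int) set set set \<Rightarrow> bool" where
  "tempered_basis scale act p Mplus Y \<longleftrightarrow>
     (let T = tempered_tensor scale act p Mplus in
      Y \<subseteq> carrier T \<and>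
      (\<forall>t\<in>carrier T. \<exists>!f :: _ \<Rightarrow>\<^sub>0 'k.
         Poly_Mapping.keys f \<subseteq> Y \<and>
         t = (\<Oplus>\<^bsub>T\<^esub>b\<in>Poly_Mapping.keys f.
                tempered_scale scale act p Mplus (Poly_Mapping.lookup f b) b)))"

section \<open>Words and reductions\<close>

text \<open>
  A word is an element of \<open>C\<close> followed by a string of letters. In the definitions below,
  \<open>L\<close> stands for \<open>B\<^sub>+\<^sub>+ \<union> B\<^sub>-\<^sub>+\<close> (the letters \<open>(xp)\<close>) and \<open>P\<close> for \<open>B\<^sub>+\<^sub>+ \<union> B\<^sub>+\<^sub>-\<close> (the letters \<open>(py)\<close>).
\<close>

type_synonym ('m, 'r) mword = "'m \<times> 'r letter list"

type_synonym ('m, 'r, 'k) mexpr = "('m, 'r) mword \<Rightarrow>\<^sub>0 'k"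

definition words :: "'r set \<Rightarrow> 'm set \<Rightarrow> ('m, 'r) mword set" where
  "words B C = {(c, u). c \<in> C \<and> set u \<subseteq> insert Q (Elt ` B)}"

definition normal_words ::
  "'r set \<Rightarrow> 'r set \<Rightarrow> 'r set \<Rightarrow> 'm set \<Rightarrow> 'm set \<Rightarrow> ('m, 'r) mword set" where
  "normal_words B L P C Cp =
     {(c, u) \<in> words B C.
        (\<forall>x\<in>B. \<forall>y\<in>B. \<not> sublist [Elt x, Elt y] u) \<and>
        (\<forall>x\<in>L. \<forall>y\<in>P. \<not> sublist [Elt x, Q, Elt y] u) \<and>
        (\<forall>y\<in>B. \<not> prefix [Elt y] u) \<and>
        (c \<in> Cp \<longrightarrow> (\<forall>y\<in>P. \<not> prefix [Q, Elt y] u))}"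

definition word_value ::
  "('k::field \<Rightarrow> 'r::ring_1 \<Rightarrow> 'r) \<Rightarrow> ('m::ab_group_add \<Rightarrow> 'r \<Rightarrow> 'm) \<Rightarrow> 'r \<Rightarrow> 'm set \<Rightarrow>
   ('m, 'r) mword \<Rightarrow> (('m \<times> ('r, 'k) free set) \<Rightarrow>\<^sub>0 int) set set" where
  "word_value scale act p Mplus w =
     foldl (\<lambda>t x. adjoin_letter scale p x \<odot>\<^bsub>tempered_tensor scale act p Mplus\<^esub> t)
       (tempered_elt scale act p Mplus (fst w)) (snd w)"

definition expr_value ::
  "('k::field \<Rightarrow> 'r::ring_1 \<Rightarrow> 'r) \<Rightarrow> ('m::ab_group_add \<Rightarrow> 'r \<Rightarrow> 'm) \<Rightarrow> 'r \<Rightarrow> 'm set \<Rightarrow>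
   ('m, 'r, 'k) mexpr \<Rightarrow> (('m \<times> ('r, 'k) free set) \<Rightarrow>\<^sub>0 int) set set" where
  "expr_value scale act p Mplus e =
     (\<Oplus>\<^bsub>tempered_tensor scale act p Mplus\<^esub>w\<in>Poly_Mapping.keys e.
        tempered_scale scale act p Mplus (Poly_Mapping.lookup e w)
          (word_value scale act p Mplus w))"

text \<open>
  The expressions \<open>f\<^sub>R\<close> and \<open>f\<^sub>M\<close>, given the value of \<open>f\<close>. The basis element \<open>1\<close> of \<open>R\<close> is
  represented by the empty string.
\<close>

definition R_expr :: "('k::field \<Rightarrow> 'r::ring_1 \<Rightarrow> 'r) \<Rightarrow> 'r set \<Rightarrow> 'r \<Rightarrow> ('r, 'k) free" where
  "R_expr scale B r =
     (let g = Modules.module.representation scale (insert 1 B) r in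
      \<Sum>b | g b \<noteq> 0. Poly_Mapping.single (if b = 1 then [] else [Elt b]) (g b))"

definition M_expr ::
  "('k::field \<Rightarrow> 'r::ring_1 \<Rightarrow> 'r) \<Rightarrow> ('m::ab_group_add \<Rightarrow> 'r \<Rightarrow> 'm) \<Rightarrow> 'm set \<Rightarrow> 'm \<Rightarrow> 'm \<Rightarrow>\<^sub>0 'k"
  where
  "M_expr scale act C m =
     (let g = Modules.module.representation (module_scale scale act) C m in
      \<Sum>c | g c \<noteq> 0. Poly_Mapping.single c (g c))"

inductive string_reduction ::
  "('k::field \<Rightarrow> 'r::ring_1 \<Rightarrow> 'r) \<Rightarrow> 'r \<Rightarrow> 'r set \<Rightarrow> 'r set \<Rightarrow> 'r set \<Rightarrow>
   'r letter list \<Rightarrow> ('r, 'k) free \<Rightarrow> bool"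
  for scale p B L P where
  "x \<in> B \<Longrightarrow> y \<in> B \<Longrightarrow>
     string_reduction scale p B L P [Elt x, Elt y] (R_expr scale B (x * y))"
| "x * p \<in> L \<Longrightarrow> p * y \<in> P \<Longrightarrow>
     string_reduction scale p B L P [Elt (x * p), Q, Elt (p * y)] (R_expr scale B (x * p * y))"

inductive head_reduction ::
  "('k::field \<Rightarrow> 'r::ring_1 \<Rightarrow> 'r) \<Rightarrow> ('m::ab_group_add \<Rightarrow> 'r \<Rightarrow> 'm) \<Rightarrow> 'r \<Rightarrow>
   'r set \<Rightarrow> 'r set \<Rightarrow> 'm set \<Rightarrow> 'm set \<Rightarrow> ('m, 'r) mword \<Rightarrow> ('m \<Rightarrow>\<^sub>0 'k) \<Rightarrow> bool"
  for scale act p B P C Cp where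
  "x \<in> C \<Longrightarrow> y \<in> B \<Longrightarrow>
     head_reduction scale act p B P C Cp (x, [Elt y]) (M_expr scale act C (act x y))"
| "x \<in> Cp \<Longrightarrow> p * y \<in> P \<Longrightarrow>
     head_reduction scale act p B P C Cp (x, [Q, Elt (p * y)]) (M_expr scale act C (act x y))"

text \<open>Replacement of one subword of a word by an expression.\<close>

inductive word_reduction ::
  "('k::field \<Rightarrow> 'r::ring_1 \<Rightarrow> 'r) \<Rightarrow> ('m::ab_group_add \<Rightarrow> 'r \<Rightarrow> 'm) \<Rightarrow> 'r \<Rightarrow>
   'r set \<Rightarrow> 'r set \<Rightarrow> 'r set \<Rightarrow> 'm set \<Rightarrow> 'm set \<Rightarrow>
   ('m, 'r) mword \<Rightarrow> ('m, 'r, 'k) mexpr \<Rightarrow> bool"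
  for scale act p B L P C Cp where
  "string_reduction scale p B L P w f \<Longrightarrow>
     word_reduction scale act p B L P C Cp (c, u @ w @ v)
       (\<Sum>z\<in>Poly_Mapping.keys f. Poly_Mapping.single (c, u @ z @ v) (Poly_Mapping.lookup f z))"
| "head_reduction scale act p B P C Cp (c, w) f \<Longrightarrow>
     word_reduction scale act p B L P C Cp (c, w @ v)
       (\<Sum>z\<in>Poly_Mapping.keys f. Poly_Mapping.single (z, v) (Poly_Mapping.lookup f z))"

definition expr_reduction ::
  "('k::field \<Rightarrow> 'r::ring_1 \<Rightarrow> 'r) \<Rightarrow> ('m::ab_group_add \<Rightarrow> 'r \<Rightarrow> 'm) \<Rightarrow> 'r \<Rightarrow>
   'r set \<Rightarrow> 'r set \<Rightarrow> 'r set \<Rightarrow> 'm set \<Rightarrow> 'm set \<Rightarrow>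
   ('m, 'r, 'k) mexpr \<Rightarrow> ('m, 'r, 'k) mexpr \<Rightarrow> bool" where
  "expr_reduction scale act p B L P C Cp e e' \<longleftrightarrow>
     (\<exists>w f. w \<in> Poly_Mapping.keys e \<and> word_reduction scale act p B L P C Cp w f \<and>
        e' = e - Poly_Mapping.single w (Poly_Mapping.lookup e w)
               + Poly_Mapping.map ((*) (Poly_Mapping.lookup e w)) f)"

end

theory Submission
  imports Defs
begin

text \<open>
  Linear independence comes from an explicit module. On the span of the normal words, \<open>q\<close> acts by
  appending \<open>q\<close>, and \<open>r \<in> R\<close> acts by recursion on the last letter: \<open>c r\<close> is computed in \<open>M\<close>;
  \<open>(w b) r = w (b r)\<close> for \<open>b \<in> B\<close>; and in \<open>(w q) r\<close> one writes \<open>r = r' + p y\<close> along the given basis,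
  appends \<open>r'\<close>, and replaces \<open>w q p y\<close> by \<open>w y\<close> if \<open>w\<close> ends in a letter \<open>xp\<close> or is an element of
  \<open>C\<^sub>+\<close>. In these cases \<open>w y\<close> depends only on \<open>p y\<close>, which makes the action associative, and
  \<open>w p\<close> is always a combination of words with such an end, which gives \<open>p q p = p\<close>. By the universal
  property of the tensor product, the module maps onto this one, taking each normal word to itself.
  Spanning follows from termination: every reduction shortens words.
\<close>

text \<open>Uniqueness of normal forms needs no inspection of overlaps between reductions:
  reductions preserve values, and values separate combinations of normal words, because the explicit
  module supplies coordinates. The conditions on M_+ let a bare head c in C_+ behave like a word
  ending in a letter xp. Annihilation by the right annihilator of p makes c y depend only on p y;
  the inclusion of Mp in M_+, together with closure under the x with px in Rp, makes the span of the
  words with such an end contain every product w p. The recursion gives additive and associative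
  operators on combinations of arbitrary words, but the unit law and p q p = p are available only on
  the span of the normal words. Hence stability of that span has to be shown before R' can act. The
  condition that 1 is not in pR + Rp enters through the basis: it allows 1 to be a basis element of
  its own, represented by the empty string.\<close>

lemma ring_of_type_algebra_simps [simp]:
  "carrier ring_of_type_algebra = UNIV"
  "x \<otimes>\<^bsub>ring_of_type_algebra\<^esub> y = x * y"
  "\<one>\<^bsub>ring_of_type_algebra\<^esub> = 1"
  "\<zero>\<^bsub>ring_of_type_algebra\<^esub> = 0"
  "x \<oplus>\<^bsub>ring_of_type_algebra\<^esub> y = x + y"
  by (simp_all add: ring_of_type_algebra_def)

lemma ring_ring_of_type_algebra: "ring (ring_of_type_algebra :: 'a::ring_1 ring)"
proof -
  have "\<exists>y. x + y = 0" for x :: 'a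
    using add.right_inverse by blast
  then show ?thesis
    unfolding ring_of_type_algebra_def using add.right_inverse
    by unfold_locales (auto simp: algebra_simps Units_def)
qed

lemma a_inv_ring_of_type_algebra [simp]:
  "\<ominus>\<^bsub>ring_of_type_algebra\<^esub> (x :: 'a::ring_1) = - x"
proof -
  interpret ring "ring_of_type_algebra :: 'a ring"
    by (rule ring_ring_of_type_algebra)
  show ?thesis
    by (rule minus_equality) simp_all
qed

section \<open>Quotients of groups with operators\<close>

text \<open>Scalars are asked to be additive in the group argument only. Right multiplication on the
  free group on pairs is not additive in the scalar, since (m, t s + t s') is not the sum of (m, t
  s) and (m, t s'); that law appears only after passing to the quotient.\<close>

locale operator_group = abelian_group T
  for S :: "'s ring" and T :: "('s, 't) module" (structure) +
  assumes smult_closed: "s \<in> carrier S \<Longrightarrow> x \<in> carrier T \<Longrightarrow> s \<odot> x \<in> carrier T"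
    and smult_add: "s \<in> carrier S \<Longrightarrow> x \<in> carrier T \<Longrightarrow> y \<in> carrier T \<Longrightarrow>
      s \<odot> (x \<oplus> y) = s \<odot> x \<oplus> s \<odot> y"
begin

lemma smult_zero:
  assumes "s \<in> carrier S"
  shows "s \<odot> \<zero> = \<zero>"
proof -
  have "s \<odot> \<zero> \<oplus> s \<odot> \<zero> = s \<odot> \<zero>"
    using assms smult_add[of s \<zero> \<zero>] by simp
  then show ?thesis
    using assms by (simp add: smult_closed)
qed

lemma smult_minus:
  assumes "s \<in> carrier S" "x \<in> carrier T"
  shows "s \<odot> (\<ominus> x) = \<ominus> (s \<odot> x)"
proof -
  have "s \<odot> (\<ominus> x) \<oplus> s \<odot> x = \<zero>"
    using assms by (simp flip: smult_add add: l_neg smult_zero)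
  then show ?thesis
    using assms by (intro minus_equality [symmetric]) (auto simp: smult_closed)
qed

lemma submodule_carrier: "submodule (carrier T) S T"
  by (rule submodule.intro) (auto simp: submodule_axioms_def smult_closed add.subgroup_self)

lemma generated_submodule_submodule:
  assumes "Y \<subseteq> carrier T"
  shows "submodule (generated_submodule S T Y) S T"
proof (rule submodule.intro)
  let ?F = "{N. submodule N S T \<and> Y \<subseteq> N}"
  have "carrier T \<in> ?F"
    using submodule_carrier assms by simp
  then have "?F \<noteq> {}"
    by blast
  then show "subgroup (generated_submodule S T Y) (add_monoid T)"
    unfolding generated_submodule_def
    by (intro add.subgroups_Inter) (auto simp: submodule_def)
  show "submodule_axioms (generated_submodule S T Y) S T"
    unfolding generated_submodule_def submodule_axioms_def
    by (auto intro: submodule.smult_closed)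
qed

end

locale operator_quotient = operator_group S T + submodule N S T
  for S :: "'s ring" and T :: "('s, 't) module" (structure) and N
begin

lemma abelian_subgroup: "abelian_subgroup N T"
  by (intro abelian_subgroupI3 additive_subgroup.intro subgroup_axioms) unfold_locales

lemma quotient_simps:
  "carrier (quotient_module T N) = (+>) N ` carrier T"
  "\<zero>\<^bsub>quotient_module T N\<^esub> = N"
  "add (quotient_module T N) = set_add T"
  by (auto simp: quotient_module_def A_RCOSETS_defs a_r_coset_def)

lemma quotient_eq_iff:
  assumes "x \<in> carrier T" "y \<in> carrier T"
  shows "N +> x = N +> y \<longleftrightarrow> x \<ominus> y \<in> N"
proof -
  interpret abelian_subgroup N T by (rule abelian_subgroup)
  show ?thesis
    using assms a_rcos_module[of y x] a_repr_independence'[of x y] a_rcos_self[of x]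
    by (auto simp: a_minus_def)
qed

lemma quotient_add:
  assumes "x \<in> carrier T" "y \<in> carrier T"
  shows "(N +> x) \<oplus>\<^bsub>quotient_module T N\<^esub> (N +> y) = N +> (x \<oplus> y)"
  using abelian_subgroup.a_rcos_sum[OF abelian_subgroup assms]
  by (simp add: quotient_simps)

lemma quotient_smult:
  assumes s: "s \<in> carrier S" and x: "x \<in> carrier T"
  shows "s \<odot>\<^bsub>quotient_module T N\<^esub> (N +> x) = N +> (s \<odot> x)"
proof -
  interpret abelian_subgroup N T by (rule abelian_subgroup)
  \<comment> \<open>Scalar multiplication in \<open>quotient_module\<close> is a union over all
    representatives of the coset, so each of them has to give the same coset.\<close>
  have "N +> (s \<odot> y) = N +> (s \<odot> x)" if "y \<in> N +> x" for y
  proof -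
    have y: "y \<in> carrier T"
      using x that by (rule a_elemrcos_carrier)
    have "y \<ominus> x \<in> N"
      using that x y by (simp add: a_rcos_module a_minus_def)
    then have "s \<odot> (y \<ominus> x) \<in> N"
      using s by (rule submodule.smult_closed[OF submodule_axioms, rotated])
    then have "s \<odot> y \<ominus> s \<odot> x \<in> N"
      using s x y by (simp add: a_minus_def smult_add smult_minus)
    then show ?thesis
      using s x y by (simp add: quotient_eq_iff smult_closed operator_group.smult_closed[OF operator_group_axioms])
  qed
  then have "(\<Union>y\<in>N +> x. N +> (s \<odot> y)) = N +> (s \<odot> x)"
    using a_rcos_self[OF x] by (intro SUP_eq_const) blast+
  then show ?thesis
    by (simp add: quotient_module_def)
qed

lemma operator_group_quotient: "operator_group S (quotient_module T N)"
proof -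
  let ?Q = "quotient_module T N"
  have zero: "\<zero>\<^bsub>?Q\<^esub> = N +> \<zero>"
    using abelian_subgroup.a_rcos_const[OF abelian_subgroup, of \<zero>]
      subgroup.one_closed[OF subgroup_axioms] by (simp add: quotient_simps)
  have "abelian_group ?Q"
  proof (rule abelian_groupI)
    fix Y assume "Y \<in> carrier ?Q"
    then obtain x where x: "x \<in> carrier T" "Y = N +> x"
      by (auto simp: quotient_simps(1))
    then have "(N +> \<ominus> x) \<oplus>\<^bsub>?Q\<^esub> Y = \<zero>\<^bsub>?Q\<^esub>" "N +> \<ominus> x \<in> carrier ?Q"
      by (auto simp: zero quotient_add l_neg quotient_simps(1))
    then show "\<exists>Z\<in>carrier ?Q. Z \<oplus>\<^bsub>?Q\<^esub> Y = \<zero>\<^bsub>?Q\<^esub>"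
      by blast
  qed (auto simp: zero quotient_simps(1) quotient_add a_ac)
  then show ?thesis
    unfolding operator_group_def operator_group_axioms_def
    by (auto simp: quotient_simps(1) quotient_smult quotient_add smult_add
        operator_group.smult_closed[OF operator_group_axioms])
qed

end

section \<open>The free abelian group on pairs and the tensor relations\<close>

lemma operator_group_free_pairs:
  assumes "ring S"
  shows "operator_group S (free_pairs S)"
proof -
  interpret ring S by fact
  have *: "Poly_Mapping.keys (frag_extend (\<lambda>(m, t). frag_of (m, t \<otimes>\<^bsub>S\<^esub> s)) c) \<subseteq> UNIV \<times> carrier S"
    if "s \<in> carrier S" "Poly_Mapping.keys c \<subseteq> UNIV \<times> carrier S"
    for s and c :: "('b \<times> 'a) \<Rightarrow>\<^sub>0 int"
    using keys_frag_extend[of "\<lambda>(m, t). frag_of (m, t \<otimes>\<^bsub>S\<^esub> s)" c] that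
    by (fastforce split: prod.splits)
  have "abelian_group (free_pairs S :: (_, ('b \<times> 'a) \<Rightarrow>\<^sub>0 int) module)"
  proof (rule abelian_groupI)
    fix c :: "('b \<times> 'a) \<Rightarrow>\<^sub>0 int"
    assume "c \<in> carrier (free_pairs S)"
    then show "\<exists>d\<in>carrier (free_pairs S). d \<oplus>\<^bsub>free_pairs S\<^esub> c = \<zero>\<^bsub>free_pairs S\<^esub>"
      by (intro bexI[of _ "- c"]) (auto simp: free_pairs_def)
  qed (auto simp: free_pairs_def dest!: subsetD[OF keys_add])
  then show ?thesis
    unfolding operator_group_def operator_group_axioms_def
    using * by (auto simp: free_pairs_def frag_extend_add)
qed

lemma free_pairs_simps [simp]:
  "\<zero>\<^bsub>free_pairs S\<^esub> = 0"
  "add (free_pairs S) = (+)"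
  "s \<odot>\<^bsub>free_pairs S\<^esub> c = frag_extend (\<lambda>(m, t). frag_of (m, t \<otimes>\<^bsub>S\<^esub> s)) c"
  "c \<in> carrier (free_pairs S) \<longleftrightarrow> Poly_Mapping.keys c \<subseteq> UNIV \<times> carrier S"
  by (auto simp: free_pairs_def)

lemma a_inv_free_pairs:
  assumes "ring S" "c \<in> carrier (free_pairs S)"
  shows "\<ominus>\<^bsub>free_pairs S\<^esub> c = - c"
proof -
  interpret operator_group S "free_pairs S"
    using assms(1) by (rule operator_group_free_pairs)
  show ?thesis
    using assms by (intro minus_equality) auto
qed

text \<open>Right multiplication by \<open>s\<close> turns each of the three kinds of tensor
  relation into a relation of the same kind, with \<open>t s\<close> in place of \<open>t\<close>;
  hence the additive subgroup that they generate is already a submodule.\<close>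

lemma submodule_tensor_subgroup:
  assumes "ring S" and j: "\<And>r. j r \<in> carrier S"
  shows "submodule (tensor_subgroup act j S) S (free_pairs S)"
proof -
  let ?F = "free_pairs S"
  interpret S: ring S by fact
  interpret operator_group S ?F
    using assms(1) by (rule operator_group_free_pairs)
  have sub: "tensor_rels act j S \<subseteq> carrier ?F"
    using j by (auto simp: tensor_rels_def dest!: subsetD[OF keys_diff] subsetD[OF keys_add]
        split: if_splits)
  have rels: "s \<odot>\<^bsub>?F\<^esub> c \<in> tensor_rels act j S"
    if "s \<in> carrier S" "c \<in> tensor_rels act j S" for s c
    using that(2) unfolding tensor_rels_def
  proof (elim UnE, goal_cases)
    case 1
    then obtain m m' t where "t \<in> carrier S"
      "c = frag_of (m + m', t) - (frag_of (m, t) + frag_of (m', t))" by blast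
    then have "s \<odot>\<^bsub>?F\<^esub> c =
        frag_of (m + m', t \<otimes>\<^bsub>S\<^esub> s) - (frag_of (m, t \<otimes>\<^bsub>S\<^esub> s) + frag_of (m', t \<otimes>\<^bsub>S\<^esub> s))"
      "t \<otimes>\<^bsub>S\<^esub> s \<in> carrier S"
      using that(1) by (simp_all add: frag_extend_add frag_extend_diff)
    then show ?case by blast
  next
    case 2
    then obtain m t t' where "t \<in> carrier S" "t' \<in> carrier S"
      "c = frag_of (m, t \<oplus>\<^bsub>S\<^esub> t') - (frag_of (m, t) + frag_of (m, t'))" by blast
    then have "s \<odot>\<^bsub>?F\<^esub> c = frag_of (m, t \<otimes>\<^bsub>S\<^esub> s \<oplus>\<^bsub>S\<^esub> t' \<otimes>\<^bsub>S\<^esub> s)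
          - (frag_of (m, t \<otimes>\<^bsub>S\<^esub> s) + frag_of (m, t' \<otimes>\<^bsub>S\<^esub> s))"
      "t \<otimes>\<^bsub>S\<^esub> s \<in> carrier S" "t' \<otimes>\<^bsub>S\<^esub> s \<in> carrier S"
      using that(1) by (simp_all add: frag_extend_add frag_extend_diff S.l_distr)
    then show ?case by blast
  next
    case 3
    then obtain m r t where "t \<in> carrier S"
      "c = frag_of (act m r, t) - frag_of (m, j r \<otimes>\<^bsub>S\<^esub> t)" by blast
    then have "s \<odot>\<^bsub>?F\<^esub> c = frag_of (act m r, t \<otimes>\<^bsub>S\<^esub> s) - frag_of (m, j r \<otimes>\<^bsub>S\<^esub> (t \<otimes>\<^bsub>S\<^esub> s))"
      "t \<otimes>\<^bsub>S\<^esub> s \<in> carrier S"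
      using that(1) j by (simp_all add: frag_extend_add frag_extend_diff S.m_assoc)
    then show ?case by blast
  qed
  have "s \<odot>\<^bsub>?F\<^esub> c \<in> tensor_subgroup act j S"
    if s: "s \<in> carrier S" and c: "c \<in> tensor_subgroup act j S" for s c
    using c unfolding tensor_subgroup_def
  proof (induction rule: generate.induct)
    case one
    then show ?case
      using generate.one[of "add_monoid ?F" "tensor_rels act j S"] by simp
  next
    case (incl h)
    then show ?case
      by (intro generate.incl rels s)
  next
    case (inv h)
    then have "h \<in> carrier ?F"
      using sub by blast
    then have "s \<odot>\<^bsub>?F\<^esub> (\<ominus>\<^bsub>?F\<^esub> h) = \<ominus>\<^bsub>?F\<^esub> (s \<odot>\<^bsub>?F\<^esub> h)"
      by (rule smult_minus[OF s])
    then show ?case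
      using generate.inv[OF rels[OF s inv], of "add_monoid ?F"] by (simp only: a_inv_def)
  next
    case (eng h1 h2)
    then show ?case
      using generate.eng[OF eng(3,4)] by (simp add: frag_extend_add)
  qed
  then show ?thesis
    using add.generate_is_subgroup[of "tensor_rels act j S"] sub
    by (auto simp: submodule_def submodule_axioms_def tensor_subgroup_def)
qed

section \<open>The algebra and the module\<close>

lemma ideal_adjoin_ideal: "ideal (adjoin_ideal scale p) ring_of_type_algebra"
  unfolding adjoin_ideal_def
  by (rule ring.genideal_ideal[OF ring_ring_of_type_algebra]) simp

lemma ring_adjoin: "ring (adjoin scale p)"
  unfolding adjoin_def by (rule ideal.quotient_is_ring[OF ideal_adjoin_ideal])

lemma carrier_adjoin: "carrier (adjoin scale p) = range (adjoin_class scale p)"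
  by (auto simp: adjoin_def FactRing_def A_RCOSETS_def' adjoin_class_def a_r_coset_def')

lemma adjoin_class_add:
  "adjoin_class scale p f \<oplus>\<^bsub>adjoin scale p\<^esub> adjoin_class scale p g = adjoin_class scale p (f + g)"
proof -
  interpret ideal "adjoin_ideal scale p" ring_of_type_algebra by (rule ideal_adjoin_ideal)
  show ?thesis
    by (simp add: adjoin_def FactRing_def adjoin_class_def a_rcos_sum)
qed

lemma adjoin_class_mult:
  "adjoin_class scale p f \<otimes>\<^bsub>adjoin scale p\<^esub> adjoin_class scale p g = adjoin_class scale p (f * g)"
proof -
  interpret ideal "adjoin_ideal scale p" ring_of_type_algebra by (rule ideal_adjoin_ideal)
  show ?thesis
    by (simp add: adjoin_def FactRing_def adjoin_class_def rcoset_mult_add)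
qed

lemma adjoin_class_one: "\<one>\<^bsub>adjoin scale p\<^esub> = adjoin_class scale p 1"
  by (simp add: adjoin_def FactRing_def adjoin_class_def)

lemma adjoin_class_eq_iff:
  "adjoin_class scale p f = adjoin_class scale p g \<longleftrightarrow> f - g \<in> adjoin_ideal scale p"
proof -
  interpret ideal "adjoin_ideal scale p" ring_of_type_algebra by (rule ideal_adjoin_ideal)
  show ?thesis
    unfolding adjoin_class_def
    using a_rcos_module[of g f] a_repr_independence'[of f g] a_rcos_self[of f]
    by auto
qed

text \<open>Stated for any coefficient group acting additively: it serves both the integer
  coefficients of the free group on pairs and the field coefficients in \<open>lin\<close>.
  Additivity alone makes a zero coefficient contribute 0, so the three supports may be enlarged to a
  common one.\<close>

lemma sum_keys_additive:
  fixes sc :: "'c::ab_group_add \<Rightarrow> 'v::ab_group_add \<Rightarrow> 'v"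
  assumes sc: "\<And>a b v. sc (a + b) v = sc a v + sc b v"
  shows "(\<Sum>i\<in>Poly_Mapping.keys (c + d). sc (Poly_Mapping.lookup (c + d) i) (h i)) =
    (\<Sum>i\<in>Poly_Mapping.keys c. sc (Poly_Mapping.lookup c i) (h i)) +
    (\<Sum>i\<in>Poly_Mapping.keys d. sc (Poly_Mapping.lookup d i) (h i))"
proof -
  have sc0: "sc 0 v = 0" for v
    using sc[of 0 0 v] by simp
  have *: "(\<Sum>i\<in>Poly_Mapping.keys e. sc (Poly_Mapping.lookup e i) (h i)) =
      (\<Sum>i\<in>Poly_Mapping.keys c \<union> Poly_Mapping.keys d. sc (Poly_Mapping.lookup e i) (h i))"
    if "Poly_Mapping.keys e \<subseteq> Poly_Mapping.keys c \<union> Poly_Mapping.keys d" for e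
    using that by (intro sum.mono_neutral_left) (auto simp: sc0 in_keys_iff)
  show ?thesis
    by (subst (1 2 3) *) (auto simp: lookup_add sc sum.distrib keys_add)
qed

section \<open>Pure tensors in the tempered tensor product\<close>

context p_tempered
begin

abbreviation "Radj \<equiv> adjoin scale p"
abbreviation "cls \<equiv> adjoin_class scale p"
abbreviation "incl r \<equiv> adjoin_letter scale p (Elt r)"
abbreviation "pairs \<equiv> free_pairs Radj"
abbreviation "ten \<equiv> tensor_subgroup act incl Radj"
abbreviation "Ext \<equiv> extension scale act p"
abbreviation "Kten \<equiv> tempered_submodule scale act p Mplus"
abbreviation "Ten \<equiv> tempered_tensor scale act p Mplus"

definition coset :: "(('m \<times> ('r, 'k) free set) \<Rightarrow>\<^sub>0 int) \<Rightarrow> _" where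
  "coset c = Kten +>\<^bsub>Ext\<^esub> (ten +>\<^bsub>pairs\<^esub> c)"

text \<open>The second factor is a polynomial in the free algebra, not its class, so that
  computations with words can be made before passing to classes.\<close>

definition tens :: "'m \<Rightarrow> ('r, 'k) free \<Rightarrow> _" where
  "tens m f = coset (frag_of (m, cls f))"

end

context p_tempered
begin

lemma cls_in_carrier [simp]: "cls f \<in> carrier Radj"
  by (simp add: carrier_adjoin)

lemma incl_eq: "incl r = cls (gen (Elt r))"
  by (simp add: adjoin_letter_def)

lemma letter_Q: "adjoin_letter scale p Q = cls (gen Q)"
  by (simp add: adjoin_letter_def)

lemma ring_Radj: "ring Radj"
  by (rule ring_adjoin)

lemma operator_group_pairs: "operator_group Radj pairs"
  by (rule operator_group_free_pairs[OF ring_Radj])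

lemma quotient_ten: "operator_quotient Radj pairs ten"
  by (intro operator_quotient.intro operator_group_pairs submodule_tensor_subgroup ring_Radj)
    (simp add: incl_eq)

lemma Ext_eq: "Ext = quotient_module pairs ten"
  by (simp add: extension_def tensor_def)

lemma operator_group_Ext: "operator_group Radj Ext"
  unfolding Ext_eq by (rule operator_quotient.operator_group_quotient[OF quotient_ten])

lemma Ext_add:
  "c \<in> carrier pairs \<Longrightarrow> d \<in> carrier pairs \<Longrightarrow>
    (ten +>\<^bsub>pairs\<^esub> c) \<oplus>\<^bsub>Ext\<^esub> (ten +>\<^bsub>pairs\<^esub> d) = ten +>\<^bsub>pairs\<^esub> (c + d)"
  unfolding Ext_eq using operator_quotient.quotient_add[OF quotient_ten] by simp

lemma Ext_smult:
  "s \<in> carrier Radj \<Longrightarrow> c \<in> carrier pairs \<Longrightarrow>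
    s \<odot>\<^bsub>Ext\<^esub> (ten +>\<^bsub>pairs\<^esub> c) = ten +>\<^bsub>pairs\<^esub> (s \<odot>\<^bsub>pairs\<^esub> c)"
  unfolding Ext_eq by (rule operator_quotient.quotient_smult[OF quotient_ten])

lemma carrier_Ext: "carrier Ext = (\<lambda>c. ten +>\<^bsub>pairs\<^esub> c) ` carrier pairs"
  unfolding Ext_eq by (rule operator_quotient.quotient_simps[OF quotient_ten])

lemma Ext_minus:
  assumes "c \<in> carrier pairs" "d \<in> carrier pairs"
  shows "(ten +>\<^bsub>pairs\<^esub> c) \<ominus>\<^bsub>Ext\<^esub> (ten +>\<^bsub>pairs\<^esub> d) = ten +>\<^bsub>pairs\<^esub> (c - d)"
proof -
  interpret P: operator_group Radj pairs by (rule operator_group_pairs)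
  interpret E: operator_group Radj Ext by (rule operator_group_Ext)
  have "c - d \<in> carrier pairs"
    using assms keys_diff by fastforce
  then have "(ten +>\<^bsub>pairs\<^esub> (c - d)) \<oplus>\<^bsub>Ext\<^esub> (ten +>\<^bsub>pairs\<^esub> d) = ten +>\<^bsub>pairs\<^esub> c"
    "ten +>\<^bsub>pairs\<^esub> (c - d) \<in> carrier Ext"
    using assms by (simp_all only: Ext_add carrier_Ext diff_add_cancel image_eqI)
  then show ?thesis
    using assms E.add.inv_solve_right'[of "ten +>\<^bsub>pairs\<^esub> (c - d)" "ten +>\<^bsub>pairs\<^esub> c" "ten +>\<^bsub>pairs\<^esub> d"]
    by (auto simp: a_minus_def a_inv_def carrier_Ext)
qed

lemma pairs_generator [simp]: "frag_of (m, cls f) \<in> carrier pairs"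
  by simp

lemma pairs_add: "c \<in> carrier pairs \<Longrightarrow> d \<in> carrier pairs \<Longrightarrow> c + d \<in> carrier pairs"
  using keys_add[of c d] by auto

lemma pairs_smult_generator:
  "cls g \<odot>\<^bsub>pairs\<^esub> frag_of (m, cls f) = frag_of (m, cls (f * g))"
  by (simp add: adjoin_class_mult)

text \<open>The generators x q p - x, computed down to the free group on pairs. In the record the
  inner scalar acts first, so q stands before p in the product.\<close>

lemma tempered_relation:
  "incl p \<odot>\<^bsub>Ext\<^esub> (adjoin_letter scale p Q \<odot>\<^bsub>Ext\<^esub> extension_elt scale act p x)
      \<ominus>\<^bsub>Ext\<^esub> extension_elt scale act p x =
    ten +>\<^bsub>pairs\<^esub> (frag_of (x, cls (gen Q * gen (Elt p))) - frag_of (x, cls 1))"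
  unfolding extension_elt_def pure_tensor_def adjoin_class_one
  by (simp only: incl_eq[of p] letter_Q Ext_smult Ext_minus cls_in_carrier pairs_generator pairs_smult_generator mult_1)

lemma quotient_Kten: "operator_quotient Radj Ext Kten"
proof (rule operator_quotient.intro[OF operator_group_Ext])
  interpret operator_group Radj pairs by (rule operator_group_pairs)
  show "submodule Kten Radj Ext"
    unfolding tempered_submodule_def Let_def tempered_relation
    by (rule operator_group.generated_submodule_submodule[OF operator_group_Ext])
      (auto simp: carrier_Ext dest!: subsetD[OF keys_diff] intro!: imageI split: if_splits)
qed

lemma operator_group_Ten: "operator_group Radj Ten"
  unfolding tempered_tensor_def by (rule operator_quotient.operator_group_quotient[OF quotient_Kten])

lemma carrier_Ten: "carrier Ten = coset ` carrier pairs"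
  unfolding tempered_tensor_def operator_quotient.quotient_simps[OF quotient_Kten] carrier_Ext
  by (auto simp: coset_def)

lemma coset_add:
  "c \<in> carrier pairs \<Longrightarrow> d \<in> carrier pairs \<Longrightarrow> coset c \<oplus>\<^bsub>Ten\<^esub> coset d = coset (c + d)"
  unfolding tempered_tensor_def coset_def
  by (subst operator_quotient.quotient_add[OF quotient_Kten])
    (simp_all only: carrier_Ext Ext_add imageI)

lemma coset_smult:
  "s \<in> carrier Radj \<Longrightarrow> c \<in> carrier pairs \<Longrightarrow> s \<odot>\<^bsub>Ten\<^esub> coset c = coset (s \<odot>\<^bsub>pairs\<^esub> c)"
  unfolding tempered_tensor_def coset_def
  by (subst operator_quotient.quotient_smult[OF quotient_Kten])
    (simp_all only: carrier_Ext Ext_smult imageI)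

lemma coset_eqI:
  assumes "c \<in> carrier pairs" "d \<in> carrier pairs" "c - d \<in> ten"
  shows "coset c = coset d"
proof -
  interpret operator_quotient Radj pairs ten by (rule quotient_ten)
  have "c \<ominus>\<^bsub>pairs\<^esub> d = c - d"
    using assms by (simp add: a_minus_def a_inv_free_pairs[OF ring_Radj])
  then show ?thesis
    using quotient_eq_iff[OF assms(1,2)] assms(3) by (simp add: coset_def)
qed

lemma coset_zero: "coset 0 = \<zero>\<^bsub>Ten\<^esub>"
proof -
  interpret operator_group Radj Ten by (rule operator_group_Ten)
  have "coset 0 \<oplus>\<^bsub>Ten\<^esub> coset 0 = coset 0" "coset 0 \<in> carrier Ten"
    by (simp_all add: coset_add carrier_Ten)
  then show ?thesis
    by (metis add.r_cancel_one')
qed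

lemma tens_in_carrier [simp]: "tens m f \<in> carrier Ten"
  unfolding tens_def carrier_Ten by (intro imageI pairs_generator)

lemma ten_incl: "c \<in> tensor_rels act incl Radj \<Longrightarrow> c \<in> ten"
  unfolding tensor_subgroup_def by (rule generate.incl)

lemma tens_add_left: "tens (m + m') f = tens m f \<oplus>\<^bsub>Ten\<^esub> tens m' f"
proof -
  have "frag_of (m + m', cls f) - (frag_of (m, cls f) + frag_of (m', cls f)) \<in> tensor_rels act incl Radj"
    unfolding tensor_rels_def using cls_in_carrier by blast
  from ten_incl[OF this] show ?thesis
    unfolding tens_def
    by (subst coset_add) (intro pairs_generator coset_eqI pairs_add | assumption)+
qed

lemma tens_add_right: "tens m (f + g) = tens m f \<oplus>\<^bsub>Ten\<^esub> tens m g"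
proof -
  have "frag_of (m, cls f \<oplus>\<^bsub>Radj\<^esub> cls g) - (frag_of (m, cls f) + frag_of (m, cls g)) \<in> tensor_rels act incl Radj"
    unfolding tensor_rels_def using cls_in_carrier by blast
  from ten_incl[OF this] show ?thesis
    unfolding tens_def adjoin_class_add
    by (subst coset_add) (intro pairs_generator coset_eqI pairs_add | assumption)+
qed

lemma tens_act: "tens (act m r) f = tens m (gen (Elt r) * f)"
proof -
  have "frag_of (act m r, cls f) - frag_of (m, incl r \<otimes>\<^bsub>Radj\<^esub> cls f) \<in> tensor_rels act incl Radj"
    unfolding tensor_rels_def using cls_in_carrier by blast
  from ten_incl[OF this] show ?thesis
    unfolding tens_def incl_eq[of r] adjoin_class_mult by (intro pairs_generator coset_eqI)
qed

lemma tens_smult: "cls g \<odot>\<^bsub>Ten\<^esub> tens m f = tens m (f * g)"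
  unfolding tens_def by (simp only: coset_smult cls_in_carrier pairs_generator pairs_smult_generator)

lemma tens_tempered:
  assumes "x \<in> Mplus"
  shows "tens x (gen Q * gen (Elt p) * f) = tens x f"
proof -
  interpret operator_quotient Radj Ext Kten by (rule quotient_Kten)
  let ?c = "frag_of (x, cls (gen Q * gen (Elt p)))" and ?d = "frag_of (x, cls 1)"
  have "incl p \<odot>\<^bsub>Ext\<^esub> (adjoin_letter scale p Q \<odot>\<^bsub>Ext\<^esub> extension_elt scale act p x)
      \<ominus>\<^bsub>Ext\<^esub> extension_elt scale act p x \<in> Kten"
    unfolding tempered_submodule_def Let_def generated_submodule_def using assms by blast
  then have "(ten +>\<^bsub>pairs\<^esub> ?c) \<ominus>\<^bsub>Ext\<^esub> (ten +>\<^bsub>pairs\<^esub> ?d) \<in> Kten"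
    by (simp only: tempered_relation Ext_minus pairs_generator)
  then have "coset ?c = coset ?d"
    unfolding coset_def
    by (subst quotient_eq_iff) (simp_all only: carrier_Ext imageI pairs_generator)
  then have "cls f \<odot>\<^bsub>Ten\<^esub> tens x (gen Q * gen (Elt p)) = cls f \<odot>\<^bsub>Ten\<^esub> tens x 1"
    by (simp add: tens_def)
  then show ?thesis
    by (simp add: tens_smult)
qed

text \<open>Every element of the free abelian group on pairs is reached from the generators by
  subtraction, so differences cover integer coefficients of both signs.\<close>

lemma Ten_induct [consumes 1, case_names tens diff]:
  assumes "t \<in> carrier Ten"
    and tens: "\<And>m f. P (tens m f)"
    and diff: "\<And>s t. s \<in> carrier Ten \<Longrightarrow> t \<in> carrier Ten \<Longrightarrow> P s \<Longrightarrow> P t \<Longrightarrow> P (s \<ominus>\<^bsub>Ten\<^esub> t)"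
  shows "P t"
proof -
  interpret operator_group Radj Ten by (rule operator_group_Ten)
  obtain c where c: "Poly_Mapping.keys c \<subseteq> UNIV \<times> carrier Radj" "t = coset c"
    using assms(1) by (auto simp: carrier_Ten)
  from c(1) have "Poly_Mapping.keys c \<subseteq> UNIV \<times> carrier Radj \<and> P (coset c)"
  proof (induction c rule: frag_induction)
    case zero
    have "P (coset 0)"
      using diff[of "tens 0 0" "tens 0 0"] tens by (simp add: coset_zero a_minus_def r_neg)
    then show ?case by simp
  next
    case (one x)
    then show ?case
      using tens[of "fst x"] by (cases x) (auto simp: tens_def carrier_adjoin)
  next
    case (diff a b)
    then have keys: "Poly_Mapping.keys (a - b) \<subseteq> UNIV \<times> carrier Radj"
      using keys_diff[of a b] by blast
    have "coset (a - b) \<oplus>\<^bsub>Ten\<^esub> coset b = coset a"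
      using keys diff by (subst coset_add) simp_all
    moreover have "coset a \<in> carrier Ten" "coset b \<in> carrier Ten" "coset (a - b) \<in> carrier Ten"
      using keys diff by (auto simp: carrier_Ten)
    ultimately have "coset (a - b) = coset a \<ominus>\<^bsub>Ten\<^esub> coset b"
      by (metis a_minus_def add.m_assoc add.r_inv a_inv_closed r_zero r_neg)
    then show ?case
      using assms(3)[of "coset a" "coset b"] diff keys \<open>coset a \<in> _\<close> \<open>coset b \<in> _\<close> by simp
  qed
  with c show ?thesis by simp
qed

text \<open>\<open>H m f\<close> stands for the intended image of m \<otimes> f. The target is a
  bare abelian group: in place of a module structure over R', the tempered relation is required with
  an arbitrary \<open>f\<close> on its right. The parameter \<open>sc\<close> is multiplication by
  integers in the target.\<close>

lemma tempered_tensor_universal: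
  fixes H :: "'m \<Rightarrow> ('r, 'k) free \<Rightarrow> 'v::ab_group_add" and sc :: "int \<Rightarrow> 'v \<Rightarrow> 'v"
  assumes sc: "\<And>a b v. sc (a + b) v = sc a v + sc b v" "\<And>v. sc 1 v = v"
    and add_left: "\<And>m m' f. H (m + m') f = H m f + H m' f"
    and add_right: "\<And>m f g. H m (f + g) = H m f + H m g"
    and ideal: "\<And>m f. f \<in> adjoin_ideal scale p \<Longrightarrow> H m f = 0"
    and act: "\<And>m r f. H (act m r) f = H m (gen (Elt r) * f)"
    and tempered: "\<And>m f. m \<in> Mplus \<Longrightarrow> H m (gen Q * gen (Elt p) * f) = H m f"
  obtains \<Phi> where "\<And>s t. s \<in> carrier Ten \<Longrightarrow> t \<in> carrier Ten \<Longrightarrow> \<Phi> (s \<oplus>\<^bsub>Ten\<^esub> t) = \<Phi> s + \<Phi> t"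
    and "\<And>m f. \<Phi> (tens m f) = H m f"
proof -
  \<comment> \<open>A class is evaluated at a chosen representative; the assumption
    \<open>ideal\<close> makes the choice immaterial.\<close>
  define h where "h = (\<lambda>(m, s). H m (SOME f. cls f = s))"
  have diff_right: "H m (f - g) = H m f - H m g" for m f g
    using add_right[of m "f - g" g] by simp
  have h: "h (m, cls f) = H m f" for m f
  proof -
    have "cls (SOME g. cls g = cls f) = cls f"
      by (rule someI) simp
    then have "H m ((SOME g. cls g = cls f) - f) = 0"
      by (intro ideal) (simp add: adjoin_class_eq_iff)
    then show ?thesis
      by (simp add: h_def diff_right)
  qed
  define \<phi> where "\<phi> c = (\<Sum>i\<in>Poly_Mapping.keys c. sc (Poly_Mapping.lookup c i) (h i))" for c
  have sc0: "sc 0 v = 0" for v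
    using sc(1)[of 0 0 v] by simp
  have \<phi>_add: "\<phi> (c + d) = \<phi> c + \<phi> d" for c d
    unfolding \<phi>_def by (rule sum_keys_additive[OF sc(1)])
  have \<phi>_diff: "\<phi> (c - d) = \<phi> c - \<phi> d" for c d
    using \<phi>_add[of "c - d" d] by simp
  have \<phi>_0: "\<phi> 0 = 0"
    by (simp add: \<phi>_def)
  have \<phi>_of: "\<phi> (frag_of (m, cls f)) = H m f" for m f
    by (simp add: \<phi>_def sc h)
  interpret P: operator_quotient Radj pairs ten by (rule quotient_ten)
  interpret E: operator_quotient Radj Ext Kten by (rule quotient_Kten)
  have pairs_minus: "c \<ominus>\<^bsub>pairs\<^esub> d = c - d" if "d \<in> carrier pairs" for c d
    using that by (simp add: a_minus_def a_inv_free_pairs[OF ring_Radj])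
  have rels: "\<phi> c = 0" if "c \<in> tensor_rels act incl Radj" for c
    using that
    by (auto simp: tensor_rels_def carrier_adjoin adjoin_class_add adjoin_class_mult incl_eq
        \<phi>_diff \<phi>_add \<phi>_of add_left add_right act)
  have sub: "tensor_rels act incl Radj \<subseteq> carrier pairs"
    by (auto simp: tensor_rels_def incl_eq carrier_adjoin adjoin_class_add adjoin_class_mult
        dest!: subsetD[OF keys_diff] subsetD[OF keys_add] split: if_splits)
  have ten: "\<phi> c = 0" if "c \<in> ten" for c
    using that unfolding tensor_subgroup_def
  proof (induction rule: generate.induct)
    case (inv h)
    then have "inv\<^bsub>add_monoid pairs\<^esub> h = - h"
      using a_inv_free_pairs[OF ring_Radj, of h] sub by (auto simp: a_inv_def)
    then show ?case
      using rels[OF inv] \<phi>_diff[of 0 h] \<phi>_0 by simp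
  qed (auto simp: \<phi>_0 rels \<phi>_add)
  \<comment> \<open>The target has no action of R', so the kernel of \<open>\<phi>\<close> is not
    visibly stable under right multiplication. \<open>Z\<close> collects the classes with a
    representative all of whose right multiples lie in the kernel; it is a submodule containing the
    generators, hence it contains \<open>Kten\<close>.\<close>
  define Z where "Z = {ten +>\<^bsub>pairs\<^esub> c | c. c \<in> carrier pairs \<and>
      (\<forall>s\<in>carrier Radj. \<phi> (s \<odot>\<^bsub>pairs\<^esub> c) = 0)}"
  have Z_E: "Z \<subseteq> carrier Ext"
    by (auto simp: Z_def carrier_Ext)
  have Z_diff: "y \<ominus>\<^bsub>Ext\<^esub> z \<in> Z" if yz: "y \<in> Z" "z \<in> Z" for y z
  proof -
    obtain c d where cd: "c \<in> carrier pairs" "d \<in> carrier pairs"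
      "y = ten +>\<^bsub>pairs\<^esub> c" "z = ten +>\<^bsub>pairs\<^esub> d"
      and 0: "\<forall>s\<in>carrier Radj. \<phi> (s \<odot>\<^bsub>pairs\<^esub> c) = 0" "\<forall>s\<in>carrier Radj. \<phi> (s \<odot>\<^bsub>pairs\<^esub> d) = 0"
      using yz unfolding Z_def by blast
    have "y \<ominus>\<^bsub>Ext\<^esub> z = ten +>\<^bsub>pairs\<^esub> (c - d)"
      unfolding cd(3,4) using cd(1,2) by (rule Ext_minus)
    moreover have "c - d \<in> carrier pairs"
      using cd(1,2) keys_diff[of c d] by auto
    moreover have "\<phi> (s \<odot>\<^bsub>pairs\<^esub> (c - d)) = 0" if "s \<in> carrier Radj" for s
      using 0 that by (simp add: frag_extend_diff \<phi>_diff)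
    ultimately show ?thesis
      unfolding Z_def by blast
  qed
  have Z_gen: "ten +>\<^bsub>pairs\<^esub> (frag_of (x, cls (gen Q * gen (Elt p))) - frag_of (x, cls 1)) \<in> Z"
    if "x \<in> Mplus" for x
  proof -
    have "frag_of (x, cls (gen Q * gen (Elt p))) - frag_of (x, cls 1) \<in> carrier pairs"
      by (auto dest!: subsetD[OF keys_diff] split: if_splits)
    moreover have "\<phi> (s \<odot>\<^bsub>pairs\<^esub> (frag_of (x, cls (gen Q * gen (Elt p))) - frag_of (x, cls 1))) = 0"
      if "s \<in> carrier Radj" for s
      using that \<open>x \<in> Mplus\<close>
      by (auto simp: carrier_adjoin frag_extend_diff adjoin_class_mult \<phi>_diff \<phi>_of tempered)
    ultimately show ?thesis
      unfolding Z_def by blast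
  qed
  have Z_smult: "s \<odot>\<^bsub>Ext\<^esub> z \<in> Z" if s: "s \<in> carrier Radj" and z: "z \<in> Z" for s z
  proof -
    obtain c where c: "c \<in> carrier pairs" "z = ten +>\<^bsub>pairs\<^esub> c"
      and 0: "\<And>s. s \<in> carrier Radj \<Longrightarrow> \<phi> (s \<odot>\<^bsub>pairs\<^esub> c) = 0"
      using z unfolding Z_def by blast
    have assoc: "s' \<odot>\<^bsub>pairs\<^esub> (s \<odot>\<^bsub>pairs\<^esub> c) = (s \<otimes>\<^bsub>Radj\<^esub> s') \<odot>\<^bsub>pairs\<^esub> c" if s': "s' \<in> carrier Radj" for s'
    proof -
      have "Poly_Mapping.keys c \<subseteq> UNIV \<times> carrier Radj"
        using c(1) by simp
      then show ?thesis
      proof (induction c rule: frag_induction)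
        case (one x)
        then show ?case
          using s s' by (auto simp: monoid.m_assoc[OF ring.is_monoid[OF ring_Radj]])
      qed (auto simp: frag_extend_diff)
    qed
    have "\<phi> (s' \<odot>\<^bsub>pairs\<^esub> (s \<odot>\<^bsub>pairs\<^esub> c)) = 0" if s': "s' \<in> carrier Radj" for s'
      unfolding assoc[OF s'] using s s' by (intro 0) (auto simp: carrier_adjoin adjoin_class_mult)
    moreover have "s \<odot>\<^bsub>Ext\<^esub> z = ten +>\<^bsub>pairs\<^esub> (s \<odot>\<^bsub>pairs\<^esub> c)"
      unfolding c(2) using s c(1) by (rule Ext_smult)
    moreover have "s \<odot>\<^bsub>pairs\<^esub> c \<in> carrier pairs"
      using s c(1) by (rule operator_group.smult_closed[OF operator_group_pairs])
    ultimately show ?thesis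
      unfolding Z_def by blast
  qed
  have "ten +>\<^bsub>pairs\<^esub> 0 \<in> Z"
  proof -
    have "0 \<in> carrier pairs" "\<forall>s\<in>carrier Radj. \<phi> (s \<odot>\<^bsub>pairs\<^esub> 0) = 0"
      using \<phi>_0 by simp_all
    then show ?thesis
      unfolding Z_def by blast
  qed
  then obtain z where z: "z \<in> Z" by blast
  have Z_zero: "\<zero>\<^bsub>Ext\<^esub> \<in> Z"
    using Z_diff[OF z z] subsetD[OF Z_E z] by (simp add: a_minus_def E.r_neg)
  have Z_inv: "\<ominus>\<^bsub>Ext\<^esub> z \<in> Z" if "z \<in> Z" for z
    using Z_diff[OF Z_zero that] Z_E that by (simp add: a_minus_def subset_iff)
  have Z_add: "y \<oplus>\<^bsub>Ext\<^esub> z \<in> Z" if "y \<in> Z" "z \<in> Z" for y z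
    using Z_diff[OF that(1) Z_inv[OF that(2)]] Z_E that by (simp add: a_minus_def subset_iff)
  have "submodule Z Radj Ext"
  proof (rule submodule.intro)
    show "subgroup Z (add_monoid Ext)"
      using Z_E z Z_inv Z_add by (intro E.add.subgroupI) (auto simp: a_inv_def)
    show "submodule_axioms Z Radj Ext"
      using Z_smult by (simp add: submodule_axioms_def)
  qed
  then have Kten_Z: "Kten \<subseteq> Z"
    unfolding tempered_submodule_def Let_def generated_submodule_def tempered_relation
    using Z_gen by blast
  have \<phi>_eq: "\<phi> c = \<phi> d" if cd: "c \<in> carrier pairs" "d \<in> carrier pairs" "coset c = coset d" for c d
  proof -
    have "(ten +>\<^bsub>pairs\<^esub> c) \<ominus>\<^bsub>Ext\<^esub> (ten +>\<^bsub>pairs\<^esub> d) \<in> Kten"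
      using cd(3) unfolding coset_def
      by (subst (asm) E.quotient_eq_iff) (use cd(1,2) in \<open>simp_all only: carrier_Ext imageI\<close>)
    then have "ten +>\<^bsub>pairs\<^esub> (c - d) \<in> Z"
      using Kten_Z cd(1,2) by (auto simp only: Ext_minus)
    then obtain b where b: "b \<in> carrier pairs" "ten +>\<^bsub>pairs\<^esub> (c - d) = ten +>\<^bsub>pairs\<^esub> b"
      "\<And>s. s \<in> carrier Radj \<Longrightarrow> \<phi> (s \<odot>\<^bsub>pairs\<^esub> b) = 0"
      unfolding Z_def by blast
    \<comment> \<open>Taking the right multiple by 1 recovers \<open>\<phi> b = 0\<close> from the
      definition of \<open>Z\<close>.\<close>
    have "cls 1 \<odot>\<^bsub>pairs\<^esub> b = b"
    proof -
      have "Poly_Mapping.keys b \<subseteq> UNIV \<times> carrier Radj"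
        using b(1) by simp
      then show ?thesis
        by (induction b rule: frag_induction)
          (auto simp: frag_extend_diff carrier_adjoin adjoin_class_mult)
    qed
    then have "\<phi> b = 0"
      using b(3)[of "cls 1"] by simp
    moreover have "c - d \<in> carrier pairs"
      using cd(1,2) keys_diff[of c d] by auto
    then have "(c - d) - b \<in> ten"
      using P.quotient_eq_iff[OF _ b(1), of "c - d"] b(2) pairs_minus[OF b(1), of "c - d"] by metis
    then have "\<phi> (c - d - b) = 0"
      by (rule ten)
    ultimately show ?thesis
      by (simp add: \<phi>_diff)
  qed
  define \<Phi> where "\<Phi> t = \<phi> (SOME c. c \<in> carrier pairs \<and> coset c = t)" for t
  have \<Phi>: "\<Phi> (coset c) = \<phi> c" if "c \<in> carrier pairs" for c
  proof -
    have "(SOME d. d \<in> carrier pairs \<and> coset d = coset c) \<in> carrier pairs \<and>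
        coset (SOME d. d \<in> carrier pairs \<and> coset d = coset c) = coset c"
      by (rule someI) (use that in blast)
    then show ?thesis
      unfolding \<Phi>_def using that by (intro \<phi>_eq) blast+
  qed
  show thesis
  proof (rule that)
    show "\<Phi> (s \<oplus>\<^bsub>Ten\<^esub> t) = \<Phi> s + \<Phi> t" if st: "s \<in> carrier Ten" "t \<in> carrier Ten" for s t
    proof -
      obtain c d where cd: "c \<in> carrier pairs" "d \<in> carrier pairs" "s = coset c" "t = coset d"
        using st by (auto simp: carrier_Ten)
      moreover have "c + d \<in> carrier pairs"
        using cd(1,2) keys_add[of c d] by auto
      ultimately show ?thesis
        by (simp only: coset_add \<Phi> \<phi>_add)
    qed
    show "\<Phi> (tens m f) = H m f" for m f
      unfolding tens_def by (simp only: \<Phi> pairs_generator \<phi>_of)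
  qed
qed

end

section \<open>Linear algebra\<close>

text \<open>Written with \<open>Poly_Mapping.map\<close> so as to coincide with the scaling in
  \<open>expr_reduction\<close>.\<close>

definition smul :: "'k::field \<Rightarrow> ('a \<Rightarrow>\<^sub>0 'k) \<Rightarrow> ('a \<Rightarrow>\<^sub>0 'k)" where
  "smul a = Poly_Mapping.map ((*) a)"

lemma lookup_smul [simp]: "Poly_Mapping.lookup (smul a e) w = a * Poly_Mapping.lookup e w"
  by (simp add: smul_def Poly_Mapping.map.rep_eq when_def)

interpretation smul: vector_space smul
  by unfold_locales (auto intro!: poly_mapping_eqI simp: lookup_add algebra_simps)

lemma smul_single [simp]: "smul a (Poly_Mapping.single w b) = Poly_Mapping.single w (a * b)"
  by (intro poly_mapping_eqI) (simp add: lookup_single when_def)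

lemma keys_smul: "Poly_Mapping.keys (smul a e) \<subseteq> Poly_Mapping.keys e"
  by (auto simp: in_keys_iff)

text \<open>Linear extension of \<open>h\<close> from words to expressions. The operators on
  expressions below are built from it, so that identities between composites reduce to single words
  by \<open>lin_lin\<close> and \<open>lin_cong\<close>.\<close>

definition lin :: "('a \<Rightarrow> 'b \<Rightarrow>\<^sub>0 'k) \<Rightarrow> ('a \<Rightarrow>\<^sub>0 'k) \<Rightarrow> ('b \<Rightarrow>\<^sub>0 'k::field)" where
  "lin h e = (\<Sum>w\<in>Poly_Mapping.keys e. smul (Poly_Mapping.lookup e w) (h w))"

lemma lin_add [simp]: "lin h (d + e) = lin h d + lin h e"
  unfolding lin_def by (rule sum_keys_additive) (rule smul.scale_left_distrib)

lemma lin_zero [simp]: "lin h 0 = 0"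
  by (simp add: lin_def)

lemma lin_single [simp]: "lin h (Poly_Mapping.single w a) = smul a (h w)"
  by (simp add: lin_def)

lemma lin_diff [simp]: "lin h (d - e) = lin h d - lin h e"
  using lin_add[of h "d - e" e] by (simp del: lin_add)

lemma lin_sum: "lin h (sum g A) = (\<Sum>i\<in>A. lin h (g i))"
  by (induction A rule: infinite_finite_induct) auto

lemma lin_smul [simp]: "lin h (smul a e) = smul a (lin h e)"
proof (cases "a = 0")
  case False
  then have "Poly_Mapping.keys (smul a e) = Poly_Mapping.keys e"
    by (auto simp: in_keys_iff)
  then show ?thesis
    by (simp add: lin_def smul.scale_sum_right)
qed simp

lemma lin_cong: "(\<And>w. w \<in> Poly_Mapping.keys e \<Longrightarrow> g w = h w) \<Longrightarrow> lin g e = lin h e"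
  by (simp add: lin_def)

lemma lin_single_id [simp]: "lin (\<lambda>w. Poly_Mapping.single w 1) e = e"
proof (rule poly_mapping_eqI)
  show "Poly_Mapping.lookup (lin (\<lambda>w. Poly_Mapping.single w 1) e) v = Poly_Mapping.lookup e v" for v
    by (auto simp: lin_def lookup_sum lookup_single when_def in_keys_iff)
qed

lemma lin_lin: "lin g (lin h e) = lin (\<lambda>w. lin g (h w)) e"
  by (simp add: lin_def[of h] lin_def[of "\<lambda>w. lin g (h w)"] lin_sum)

lemma lin_add_fun: "lin (\<lambda>w. g w + h w) e = lin g e + lin h e"
  by (simp add: lin_def smul.scale_right_distrib sum.distrib)

lemma lin_smul_fun: "lin (\<lambda>w. smul a (h w)) e = smul a (lin h e)"
  unfolding lin_def smul.scale_sum_right by (intro sum.cong refl smul.scale_left_commute)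

lemma keys_lin: "Poly_Mapping.keys (lin h e) \<subseteq> (\<Union>w\<in>Poly_Mapping.keys e. Poly_Mapping.keys (h w))"
  unfolding lin_def by (rule order.trans[OF keys_sum]) (intro UN_mono subset_refl keys_smul)

lemma keys_lin_subset:
  "(\<And>w. w \<in> Poly_Mapping.keys e \<Longrightarrow> Poly_Mapping.keys (h w) \<subseteq> Y) \<Longrightarrow> Poly_Mapping.keys (lin h e) \<subseteq> Y"
  by (rule order.trans[OF keys_lin UN_least])

lemma sum_single_eq_lin:
  "(\<Sum>z\<in>Poly_Mapping.keys f. Poly_Mapping.single (g z) (Poly_Mapping.lookup f z)) =
    lin (\<lambda>z. Poly_Mapping.single (g z) 1) f"
  by (simp add: lin_def)

lemma additive_eqI:
  fixes F G :: "('a \<Rightarrow>\<^sub>0 'k::field) \<Rightarrow> 'v::ab_group_add"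
  assumes "\<And>d e. F (d + e) = F d + F e" "\<And>d e. G (d + e) = G d + G e"
    and "\<And>w a. w \<in> Poly_Mapping.keys e \<Longrightarrow> F (Poly_Mapping.single w a) = G (Poly_Mapping.single w a)"
  shows "F e = G e"
proof -
  have zero: "F 0 = 0" "G 0 = 0"
    using assms(1)[of 0 0] assms(2)[of 0 0] by simp_all
  have "F (\<Sum>w\<in>A. Poly_Mapping.single w (Poly_Mapping.lookup e w)) =
      G (\<Sum>w\<in>A. Poly_Mapping.single w (Poly_Mapping.lookup e w))"
    if "A \<subseteq> Poly_Mapping.keys e" for A
    using finite_subset[OF that] that
    by (induction A rule: infinite_finite_induct) (auto simp: assms zero)
  from this[OF subset_refl] show ?thesis
    using sum_single_eq_lin[of "\<lambda>w. w" e] by simp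
qed

text \<open>Common form of \<open>R_expr\<close> and \<open>M_expr\<close>. The word for a basis
  element is given by \<open>enc\<close>: in R the empty string for 1 and one letter otherwise, in M
  the basis element itself.\<close>

definition expansion ::
  "('k::field \<Rightarrow> 'v::ab_group_add \<Rightarrow> 'v) \<Rightarrow> 'v set \<Rightarrow> ('v \<Rightarrow> 'c) \<Rightarrow> 'v \<Rightarrow> ('c \<Rightarrow>\<^sub>0 'k)" where
  "expansion scale B enc v =
    (let g = Modules.module.representation scale B v in
      \<Sum>b | g b \<noteq> 0. Poly_Mapping.single (enc b) (g b))"

section \<open>Relative bases and expansions in a basis\<close>

context vector_space
begin

text \<open>Passes from a sum over a finite set to a finitely supported function, the form that
  coefficients have in \<open>relative_basis\<close>.\<close>

lemma combination_of_sum: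
  assumes "finite t"
  obtains f where "Poly_Mapping.keys f \<subseteq> t" "\<And>x. x \<in> t \<Longrightarrow> Poly_Mapping.lookup f x = r x"
    "(\<Sum>b\<in>Poly_Mapping.keys f. scale (Poly_Mapping.lookup f b) b) = (\<Sum>b\<in>t. scale (r b) b)"
proof
  define f where "f = (\<Sum>x\<in>t. Poly_Mapping.single x (r x))"
  have lookup: "Poly_Mapping.lookup f x = (if x \<in> t then r x else 0)" for x
    using assms by (simp add: f_def lookup_sum lookup_single when_def)
  then show "Poly_Mapping.keys f \<subseteq> t" "\<And>x. x \<in> t \<Longrightarrow> Poly_Mapping.lookup f x = r x"
    by (auto simp: in_keys_iff split: if_splits)
  then show "(\<Sum>b\<in>Poly_Mapping.keys f. scale (Poly_Mapping.lookup f b) b) = (\<Sum>b\<in>t. scale (r b) b)"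
    using assms lookup by (intro sum.mono_neutral_cong_left) (auto simp: in_keys_iff)
qed

lemma relative_basis_independent:
  assumes rel: "relative_basis scale V U B" and U: "subspace U" "U \<subseteq> V"
  shows "independent B" "span B \<inter> U \<subseteq> {0}"
proof -
  have eq0: "f = 0" if "Poly_Mapping.keys f \<subseteq> B"
    "(\<Sum>b\<in>Poly_Mapping.keys f. scale (Poly_Mapping.lookup f b) b) \<in> U" (is "?v \<in> U") for f
  proof -
    have "\<exists>!uf. fst uf \<in> U \<and> Poly_Mapping.keys (snd uf) \<subseteq> B \<and>
        ?v = fst uf + (\<Sum>b\<in>Poly_Mapping.keys (snd uf). scale (Poly_Mapping.lookup (snd uf) b) b)"
      using rel that(2) U(2) unfolding relative_basis_def by blast
    \<comment> \<open>Since \<open>?v\<close> lies in \<open>U\<close>, both pairs decompose it;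
      uniqueness identifies them.\<close>
    then have "(0, f) = (?v, 0)"
      by (rule ex1E) (use that U(1) in \<open>auto simp: subspace_0\<close>)
    then show ?thesis by simp
  qed
  show "independent B"
    unfolding independent_explicit_finite_subsets
  proof (intro allI impI ballI)
    fix S u v assume "S \<subseteq> B" "finite S" "(\<Sum>v\<in>S. scale (u v) v) = 0" "v \<in> S"
    then show "u v = 0"
      using combination_of_sum[of S u] eq0 subspace_0[OF U(1)]
      by (metis lookup_zero subset_trans)
  qed
  show "span B \<inter> U \<subseteq> {0}"
  proof
    fix x assume x: "x \<in> span B \<inter> U"
    then obtain t r where "finite t" "t \<subseteq> B" "x = (\<Sum>b\<in>t. scale (r b) b)"
      by (auto simp: span_explicit)
    then obtain f where f: "Poly_Mapping.keys f \<subseteq> B"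
      "x = (\<Sum>b\<in>Poly_Mapping.keys f. scale (Poly_Mapping.lookup f b) b)"
      using combination_of_sum[of t r] by (metis subset_trans)
    then show "x \<in> {0}"
      using eq0[of f] x by auto
  qed
qed

lemma independent_Un:
  assumes "independent A" "independent B" "span A \<inter> span B \<subseteq> {0}"
  shows "independent (A \<union> B)"
proof
  assume "dependent (A \<union> B)"
  then obtain a where a: "a \<in> A \<union> B" "a \<in> span (A \<union> B - {a})"
    by (auto simp: dependent_def)
  have "A \<union> B - {a} = (A - {a}) \<union> (B - {a})" by auto
  then obtain x y where xy: "a = x + y" "x \<in> span (A - {a})" "y \<in> span (B - {a})"
    using a(2) by (auto simp: span_Un)
  have x: "x \<in> span A" and y: "y \<in> span B"
    using xy(2,3) span_mono[of "A - {a}" A] span_mono[of "B - {a}" B] by auto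
  show False
  proof (cases "a \<in> A")
    case True
    have "a - x \<in> span A"
      using x span_base[OF True] by (intro span_diff)
    then have "y = 0"
      using assms(3) y xy(1) by auto
    then show False
      using True assms(1) xy by (auto simp: dependent_def)
  next
    case False
    then have B: "a \<in> B" using a(1) by simp
    then have "a - y \<in> span B"
      using y span_base[OF B] by (intro span_diff)
    then have "x = 0"
      using assms(3) x xy(1) by auto
    then show False
      using B assms(2) xy by (auto simp: dependent_def)
  qed
qed

lemma relative_basis_span:
  assumes rel: "relative_basis scale V U B" and V: "subspace V" "U \<subseteq> V" and A: "span A = U"
  shows "span (A \<union> B) = V"
proof
  show "span (A \<union> B) \<subseteq> V"
    using rel V A span_superset[of A] by (intro span_minimal) (auto simp: relative_basis_def)
  show "V \<subseteq> span (A \<union> B)"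
  proof
    fix v assume "v \<in> V"
    then have "\<exists>!uf. fst uf \<in> U \<and> Poly_Mapping.keys (snd uf) \<subseteq> B \<and>
        v = fst uf + (\<Sum>b\<in>Poly_Mapping.keys (snd uf). scale (Poly_Mapping.lookup (snd uf) b) b)"
      using rel unfolding relative_basis_def by blast
    then obtain uf where uf: "fst uf \<in> U" "Poly_Mapping.keys (snd uf) \<subseteq> B"
      "v = fst uf + (\<Sum>b\<in>Poly_Mapping.keys (snd uf). scale (Poly_Mapping.lookup (snd uf) b) b)"
      by blast
    have "(\<Sum>b\<in>Poly_Mapping.keys (snd uf). scale (Poly_Mapping.lookup (snd uf) b) b) \<in> span B"
      using uf(2) by (intro span_sum span_scale span_base) auto
    then show "v \<in> span (A \<union> B)"
      using uf(1,3) A by (auto simp: span_Un)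
  qed
qed

lemma expansion_eq:
  "finite A \<Longrightarrow> {b. representation B v b \<noteq> 0} \<subseteq> A \<Longrightarrow>
    expansion scale B enc v = (\<Sum>b\<in>A. Poly_Mapping.single (enc b) (representation B v b))"
  unfolding expansion_def Let_def by (rule sum.mono_neutral_left) auto

lemma expansion_add:
  assumes B: "independent B" "span B = UNIV"
  shows "expansion scale B enc (u + v) = expansion scale B enc u + expansion scale B enc v"
proof -
  let ?A = "{b. representation B u b \<noteq> 0} \<union> {b. representation B v b \<noteq> 0}"
  have fin: "finite ?A"
    by (simp add: finite_representation)
  have "representation B (u + v) = (\<lambda>b. representation B u b + representation B v b)"
    using B by (simp add: representation_add)
  then show ?thesis
    by (subst (1 2 3) expansion_eq[OF fin]) (auto simp: single_add sum.distrib)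
qed

lemma expansion_scale:
  assumes B: "independent B" "span B = UNIV"
  shows "expansion scale B enc (scale a v) = smul a (expansion scale B enc v)"
proof -
  let ?A = "{b. representation B v b \<noteq> 0}"
  have fin: "finite ?A"
    by (simp add: finite_representation)
  have "representation B (scale a v) = (\<lambda>b. a * representation B v b)"
    using B by (simp add: representation_scale)
  then show ?thesis
    by (subst (1 2) expansion_eq[OF fin]) (auto simp: smul.scale_sum_right)
qed

lemma expansion_basis: "independent B \<Longrightarrow> b \<in> B \<Longrightarrow> expansion scale B enc b = Poly_Mapping.single (enc b) 1"
  by (simp add: expansion_def Let_def representation_basis)

lemma keys_expansion:
  assumes "independent B" "S \<subseteq> B" "v \<in> span S"
  shows "Poly_Mapping.keys (expansion scale B enc v) \<subseteq> enc ` S"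
proof -
  have "representation B v = representation S v"
    using assms by (simp add: representation_extend)
  then have "Poly_Mapping.keys (expansion scale B enc v) \<subseteq> (\<Union>b\<in>{b. representation S v b \<noteq> 0}. {enc b})"
    unfolding expansion_def Let_def by (intro order.trans[OF keys_sum]) (auto split: if_splits)
  then show ?thesis
    by (auto dest: representation_ne_zero)
qed

text \<open>A linear map is determined by its values on the basis, so identities involving
  \<open>rexp\<close> or \<open>M_expr\<close> need to be checked on basis elements only.\<close>

lemma lin_expansion:
  assumes B: "independent B" "span B = UNIV"
    and g: "\<And>u v. g (u + v) = g u + g v" "\<And>a v. g (scale a v) = smul a (g v)"
    and h: "\<And>b. b \<in> B \<Longrightarrow> h (enc b) = g b"
  shows "lin h (expansion scale B enc v) = g v"
proof -
  have g0: "g 0 = 0"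
    using g(1)[of 0 0] by simp
  have g_sum: "g (sum f A) = (\<Sum>i\<in>A. g (f i))" for f and A :: "'b set"
    by (induction A rule: infinite_finite_induct) (simp_all add: g g0)
  have "lin h (expansion scale B enc v) = (\<Sum>b | representation B v b \<noteq> 0. smul (representation B v b) (g b))"
    unfolding expansion_def Let_def lin_sum using h by (auto intro!: sum.cong dest: representation_ne_zero)
  also have "\<dots> = g (\<Sum>b | representation B v b \<noteq> 0. scale (representation B v b) b)"
    by (simp add: g_sum g)
  also have "\<dots> = g v"
    using B by (simp add: sum_nonzero_representation_eq)
  finally show ?thesis .
qed

end

section \<open>The action on normal words\<close>

lemma ideal_ring_of_type_algebraI:
  fixes I :: "'a::ring_1 set"
  assumes "0 \<in> I" "\<And>x y. x \<in> I \<Longrightarrow> y \<in> I \<Longrightarrow> x - y \<in> I"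
    and "\<And>x y. x \<in> I \<Longrightarrow> y * x \<in> I" "\<And>x y. x \<in> I \<Longrightarrow> x * y \<in> I"
  shows "ideal I ring_of_type_algebra"
proof (rule idealI)
  show "ring (ring_of_type_algebra :: 'a ring)"
    by (rule ring_ring_of_type_algebra)
  interpret ring "ring_of_type_algebra :: 'a ring"
    by (rule ring_ring_of_type_algebra)
  have minus: "- x \<in> I" if "x \<in> I" for x
    using assms(2)[OF assms(1) that] by simp
  show "subgroup I (add_monoid ring_of_type_algebra)"
  proof (rule add.subgroupI, goal_cases)
    case (3 x)
    then show ?case
      using minus[of x] a_inv_ring_of_type_algebra[of x] unfolding a_inv_def by simp
  next
    case (4 x y)
    then show ?case
      using assms(2)[of x "- y"] minus[of y] by simp
  qed (use assms(1) in auto)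
qed (use assms in auto)

text \<open>The four pieces of the basis enter the argument only through two unions:
  \<open>L\<close>, the letters xp, which spans Rp, and \<open>P\<close>, the letters py, which
  spans pR. Since 1 is not in \<open>B\<close>, every element of \<open>B\<close> is represented by
  a one-letter string.\<close>

locale tempered_bases = p_tempered scale act p Mplus
  for scale :: "'k::field \<Rightarrow> 'r::ring_1 \<Rightarrow> 'r"
    and act :: "'m::ab_group_add \<Rightarrow> 'r \<Rightarrow> 'm" and p Mplus +
  fixes B L P :: "'r set" and C Cp :: "'m set"
  assumes independent_B: "\<not> Modules.module.dependent scale (insert 1 B)"
    and span_B: "Modules.module.span scale (insert 1 B) = UNIV"
    and one_notin_B: "1 \<notin> B"
    and L_subset: "L \<subseteq> B" and P_subset: "P \<subseteq> B"
    and span_L: "Modules.module.span scale L = range (\<lambda>x. x * p)"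
    and span_P: "Modules.module.span scale P = range (\<lambda>x. p * x)"
    and independent_C: "\<not> Modules.module.dependent (module_scale scale act) C"
    and span_C: "Modules.module.span (module_scale scale act) C = UNIV"
    and Cp_subset: "Cp \<subseteq> C"
    and span_Cp: "Modules.module.span (module_scale scale act) Cp = Mplus"

lemma (in p_tempered) vector_space_module: "vector_space (module_scale scale act)"
proof
  show "module_scale scale act a (x + y) = module_scale scale act a x + module_scale scale act a y" for a x y
    by (simp add: module_scale_def act_add_left)
  show "module_scale scale act (a + b) x = module_scale scale act a x + module_scale scale act b x" for a b x
    by (simp add: module_scale_def scale_left_distrib act_add_right)
  show "module_scale scale act a (module_scale scale act b x) = module_scale scale act (a * b) x" for a b x
    by (simp add: module_scale_def mult_scale_left mult_scale_right mult.commute flip: act_mult)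
  show "module_scale scale act 1 x = x" for x
    by (simp add: module_scale_def act_one)
qed

context tempered_bases
begin

sublocale M: vector_space "module_scale scale act"
  by (rule vector_space_module)

definition str :: "'r \<Rightarrow> 'r letter list" where
  "str b = (if b = 1 then [] else [Elt b])"

definition rexp :: "'r \<Rightarrow> ('r, 'k) free" where
  "rexp = R_expr scale B"

definition mexp :: "'m \<Rightarrow> ('m, 'r, 'k) mexpr" where
  "mexp m = lin (\<lambda>z. Poly_Mapping.single (z, []) 1) (M_expr scale act C m)"

lemma rexp_eq: "rexp r = expansion scale (insert 1 B) str r"
  by (simp add: rexp_def R_expr_def expansion_def str_def)

lemma M_expr_eq: "M_expr scale act C m = expansion (module_scale scale act) C (\<lambda>c. c) m"
  by (simp add: M_expr_def expansion_def)

lemma rexp_add [simp]: "rexp (r + s) = rexp r + rexp s"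
  and rexp_scale [simp]: "rexp (scale a r) = smul a (rexp r)"
  and rexp_basis: "b \<in> insert 1 B \<Longrightarrow> rexp b = Poly_Mapping.single (str b) 1"
  unfolding rexp_eq using independent_B span_B
  by (simp_all add: expansion_add expansion_scale expansion_basis)

lemma keys_rexp: "S \<subseteq> insert 1 B \<Longrightarrow> r \<in> span S \<Longrightarrow> Poly_Mapping.keys (rexp r) \<subseteq> str ` S"
  unfolding rexp_eq using independent_B by (rule keys_expansion)

lemma lin_rexp:
  assumes "\<And>u v. g (u + v) = g u + g v" "\<And>a v. g (scale a v) = smul a (g v)"
    and "\<And>b. b \<in> insert 1 B \<Longrightarrow> h (str b) = g b"
  shows "lin h (rexp r) = g r"
  unfolding rexp_eq using independent_B span_B assms by (rule lin_expansion)

lemma mexp_add [simp]: "mexp (m + n) = mexp m + mexp n"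
  unfolding mexp_def M_expr_eq by (simp add: M.expansion_add[OF independent_C span_C])

lemma mexp_scale [simp]: "mexp (module_scale scale act a m) = smul a (mexp m)"
  unfolding mexp_def M_expr_eq by (simp add: M.expansion_scale[OF independent_C span_C])

lemma mexp_basis: "c \<in> C \<Longrightarrow> mexp c = Poly_Mapping.single (c, []) 1"
  unfolding mexp_def M_expr_eq by (simp add: M.expansion_basis[OF independent_C])

lemma keys_mexp: "S \<subseteq> C \<Longrightarrow> m \<in> M.span S \<Longrightarrow> Poly_Mapping.keys (mexp m) \<subseteq> S \<times> {[]}"
  unfolding mexp_def M_expr_eq
  using M.keys_expansion[OF independent_C, of S m "\<lambda>c. c"] by (intro keys_lin_subset) auto

lemma lin_M_expr:
  assumes "\<And>u v. g (u + v) = g u + g v" "\<And>a v. g (module_scale scale act a v) = smul a (g v)"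
    and "\<And>c. c \<in> C \<Longrightarrow> h c = g c"
  shows "lin h (M_expr scale act C m) = g m"
  unfolding M_expr_eq using independent_C span_C assms by (rule M.lin_expansion)

lemma act_scale: "act m (scale a r) = module_scale scale act a (act m r)"
  by (simp add: module_scale_def mult_scale_right flip: act_mult)

lemma act_module_scale: "act (module_scale scale act a m) r = module_scale scale act a (act m r)"
  by (simp add: module_scale_def mult_scale_left mult_scale_right flip: act_mult)

lemma act_diff: "act m (r - s) = act m r - act m s"
  using act_add_right[of m "r - s" s] by simp

text \<open>
  A linear section of \<open>y \<mapsto> p y\<close>, extended by zero to the complement of \<open>p R\<close> spanned by the
  remaining basis elements.
\<close>

definition sec :: "'r \<Rightarrow> 'r" where
  "sec = (SOME g. Vector_Spaces.linear scale scale g \<and>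
    (\<forall>b\<in>insert 1 B. g b = (if b \<in> P then (SOME y. b = p * y) else 0)))"

lemma sec_linear: "Vector_Spaces.linear scale scale sec"
  and sec_basis: "b \<in> insert 1 B \<Longrightarrow> sec b = (if b \<in> P then (SOME y. b = p * y) else 0)"
proof -
  interpret vector_space_pair scale scale by unfold_locales
  note someI_ex[OF linear_independent_extend[OF independent_B,
        of "\<lambda>b. if b \<in> P then (SOME y. b = p * y) else 0"], folded sec_def]
  then show "Vector_Spaces.linear scale scale sec"
    "b \<in> insert 1 B \<Longrightarrow> sec b = (if b \<in> P then (SOME y. b = p * y) else 0)"
    by blast+
qed

lemma sec_add [simp]: "sec (r + s) = sec r + sec s"
  using sec_linear by (simp add: Vector_Spaces.linear_def module_hom_def module_hom_axioms_def)

lemma sec_scale [simp]: "sec (scale a r) = scale a (sec r)"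
  using sec_linear by (simp add: Vector_Spaces.linear_def module_hom_def module_hom_axioms_def)

lemma sec_notin_P: "b \<in> insert 1 B \<Longrightarrow> b \<notin> P \<Longrightarrow> sec b = 0"
  by (simp add: sec_basis)

lemma p_sec_P: "b \<in> P \<Longrightarrow> p * sec b = b"
proof -
  assume b: "b \<in> P"
  then have "b \<in> range (\<lambda>x. p * x)"
    using span_P span_superset[of P] by auto
  then have "b = p * (SOME y. b = p * y)"
    by (intro someI_ex[of "\<lambda>y. b = p * y"]) auto
  then show ?thesis
    using b P_subset sec_basis[of b] by auto
qed

text \<open>In general \<open>sec (p * y)\<close> is not \<open>y\<close>; the two differ by some r
  with p r = 0, and such an r acts as zero behind a tempered end.\<close>

lemma p_sec: "p * sec (p * y) = p * y"
proof -
  have "p * y \<in> span P"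
    by (simp add: span_P)
  then show ?thesis
    by (induction rule: span_induct_alt)
      (use sec_add[of 0 0] in \<open>auto simp: p_sec_P distrib_left mult_scale_right\<close>)
qed

text \<open>Applying \<open>sec\<close> and multiplying by \<open>p\<close> fixes the elements of
  \<open>P\<close> and kills the other basis elements, so subtracting the result deletes the
  coordinates in \<open>P\<close> and creates no new ones. This is used for
  \<open>insert 1 B\<close>, and for \<open>L\<close> when the argument lies in Rp.\<close>

lemma complement_in_span:
  assumes S: "S \<subseteq> insert 1 B" and r: "r \<in> span S"
  shows "r - p * sec r \<in> span (S - P)"
  using r
proof (induction rule: span_induct_alt)
  case base
  then show ?case
    using sec_add[of 0 0] by (simp add: span_zero)
next
  case (step a x y)
  have "scale a x - p * sec (scale a x) \<in> span (S - P)"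
  proof (cases "x \<in> P")
    case True
    then show ?thesis
      by (simp add: mult_scale_right p_sec_P span_zero)
  next
    case False
    then show ?thesis
      using step(1) S span_base[of x "S - P"] by (auto simp: sec_notin_P subset_iff span_scale)
  qed
  from span_add[OF this step(2)] show ?case
    by (simp add: algebra_simps)
qed

text \<open>The projection onto the span of \<open>P\<close> only deletes coordinates, so it maps
  the span of \<open>L\<close>, which is Rp, into itself. This supplies the condition under which
  \<open>Mplus\<close> is closed when \<open>sec r\<close> acts on it.\<close>

lemma p_sec_in_span_L:
  assumes r: "r \<in> span L"
  shows "p * sec r \<in> range (\<lambda>x. x * p)"
proof -
  have "p * sec r \<in> span L"
    using r
  proof (induction rule: span_induct_alt)
    case base
    then show ?case
      using sec_add[of 0 0] by (simp add: span_zero)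
  next
    case (step a x y)
    have "p * sec x \<in> span L"
      using step(1) L_subset sec_notin_P[of x] by (cases "x \<in> P") (auto simp: p_sec_P span_base span_zero)
    then show ?case
      using step(2) by (simp add: distrib_left mult_scale_right span_add span_scale)
  qed
  then show ?thesis
    by (simp add: span_L)
qed

text \<open>The functions from here to \<open>reduced\<close> take the string of letters backwards, the last letter first.\<close>

primrec tempered_end :: "'m \<Rightarrow> 'r letter list \<Rightarrow> bool" where
  "tempered_end c [] \<longleftrightarrow> c \<in> Cp"
| "tempered_end c (x # u) \<longleftrightarrow> (case x of Elt b \<Rightarrow> b \<in> L | Q \<Rightarrow> False)"

text \<open>Only the argument \<open>u\<close> is reversed; the words produced are in reading
  order.\<close>

definition app :: "'m \<Rightarrow> 'r letter list \<Rightarrow> 'r \<Rightarrow> ('m, 'r, 'k) mexpr" where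
  "app c u r = lin (\<lambda>z. Poly_Mapping.single (c, rev u @ Q # z) 1) (rexp r)"

text \<open>
  The action of \<open>r\<close> on the word \<open>c u\<close>: after a final \<open>q\<close> that is preceded by a letter \<open>xp\<close> or an
  element of \<open>M\<^sub>+\<close>, the component \<open>p y\<close> of \<open>r\<close> in \<open>p R\<close> is absorbed, since \<open>x p q p y = x p y\<close>.
\<close>

primrec rmul_word :: "'m \<Rightarrow> 'r letter list \<Rightarrow> 'r \<Rightarrow> ('m, 'r, 'k) mexpr" where
  "rmul_word c [] r = mexp (act c r)"
| "rmul_word c (x # u) r = (case x of Elt b \<Rightarrow> rmul_word c u (b * r)
    | Q \<Rightarrow> if tempered_end c u then app c u (r - p * sec r) + rmul_word c u (sec r) else app c u r)"

lemma app_add [simp]: "app c u (r + s) = app c u r + app c u s"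
  and app_scale [simp]: "app c u (scale a r) = smul a (app c u r)"
  by (simp_all add: app_def)

lemma rmul_word_add [simp]: "rmul_word c u (r + s) = rmul_word c u r + rmul_word c u s"
proof (induction u arbitrary: r s)
  case (Cons x u)
  have "app c u (r + s - p * (sec r + sec s)) = app c u (r - p * sec r) + app c u (s - p * sec s)"
    unfolding app_add[symmetric] by (simp add: algebra_simps)
  then show ?case
    by (cases x) (simp_all add: Cons distrib_left)
qed (simp add: act_add_right)

lemma rmul_word_scale [simp]: "rmul_word c u (scale a r) = smul a (rmul_word c u r)"
proof (induction u arbitrary: r)
  case (Cons x u)
  have "app c u (scale a r - p * scale a (sec r)) = smul a (app c u (r - p * sec r))"
    unfolding app_scale[symmetric] by (simp add: mult_scale_right scale_right_diff_distrib)
  then show ?case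
    by (cases x) (simp_all add: Cons mult_scale_right smul.scale_right_distrib)
qed (simp add: act_scale)

text \<open>A letter b of \<open>L\<close> has the form z p, so b y = z (p y). For the empty string
  the head lies in M_+, and y - y' acts on it as zero because it lies in the right annihilator of
  p.\<close>

lemma rmul_word_cong:
  assumes "tempered_end c u" "p * y = p * y'"
  shows "rmul_word c u y = rmul_word c u y'"
proof (cases u)
  case Nil
  have "act c (y - y') = 0"
    using assms Nil span_Cp M.span_superset[of Cp]
    by (intro annihilated) (auto simp: right_diff_distrib)
  then show ?thesis
    using Nil by (simp add: act_diff)
next
  case (Cons x v)
  then obtain b where b: "x = Elt b" "b \<in> L"
    using assms(1) by (auto split: letter.splits)
  then obtain z where "b = z * p"
    using span_L span_superset[of L] by blast
  then show ?thesis
    using Cons b assms(2) by (simp add: mult.assoc)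
qed

text \<open>The absorption rule w q p y = w y. An element of pR leaves no part to append after q,
  and \<open>sec (p * y)\<close> may be exchanged for \<open>y\<close> behind a tempered
  end.\<close>

lemma rmul_word_Q_p:
  assumes "tempered_end c u"
  shows "rmul_word c (Q # u) (p * y) = rmul_word c u y"
proof -
  have "app c u (p * y - p * sec (p * y)) = 0"
    using app_scale[of c u 0 0] by (simp add: p_sec)
  then show ?thesis
    using rmul_word_cong[OF assms p_sec] assms by simp
qed

definition rmul :: "('m, 'r, 'k) mexpr \<Rightarrow> 'r \<Rightarrow> ('m, 'r, 'k) mexpr" where
  "rmul e r = lin (\<lambda>(c, u). rmul_word c (rev u) r) e"

lemma rmul_linear [simp]:
  "rmul (d + e) r = rmul d r + rmul e r" "rmul 0 r = 0" "rmul (smul a e) r = smul a (rmul e r)"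
  "rmul (Poly_Mapping.single (c, u) a) r = smul a (rmul_word c (rev u) r)"
  by (simp_all add: rmul_def)

lemma rmul_add_right: "rmul e (r + s) = rmul e r + rmul e s"
  unfolding rmul_def lin_add_fun[symmetric] by (intro lin_cong) auto

lemma rmul_scale_right: "rmul e (scale a r) = smul a (rmul e r)"
  unfolding rmul_def lin_smul_fun[symmetric] by (intro lin_cong) auto

lemma rmul_mexp: "rmul (mexp m) s = mexp (act m s)"
proof -
  have "rmul (mexp m) s = lin (\<lambda>z. mexp (act z s)) (M_expr scale act C m)"
    by (simp add: rmul_def mexp_def lin_lin)
  also have "\<dots> = mexp (act m s)"
    by (rule lin_M_expr) (simp_all add: act_add_left act_module_scale)
  finally show ?thesis .
qed

text \<open>A word of \<open>app\<close> ends in q or in one basis letter b after it; the recursion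
  moves such a letter into the argument as b s. Linearity in b then replaces it by r.\<close>

lemma rmul_app: "rmul (app c u r) s = rmul_word c (Q # u) (r * s)"
proof -
  have "rmul (app c u r) s = lin (\<lambda>z. rmul_word c (rev z @ Q # u) s) (rexp r)"
    by (simp add: rmul_def app_def lin_lin)
  also have "\<dots> = rmul_word c (Q # u) (r * s)"
  proof (rule lin_rexp)
    show "rmul_word c (rev (str b) @ Q # u) s = rmul_word c (Q # u) (b * s)" for b
      by (auto simp: str_def)
  qed (simp_all only: distrib_right mult_scale_left rmul_word_add rmul_word_scale)
  finally show ?thesis .
qed

lemma rmul_rmul_word: "rmul (rmul_word c u r) s = rmul_word c u (r * s)"
proof (induction u arbitrary: r)
  case Nil
  then show ?case
    by (simp add: rmul_mexp act_mult)
next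
  case (Cons x u)
  show ?case
  proof (cases x)
    case (Elt b)
    then show ?thesis
      by (simp add: Cons mult.assoc)
  next
    case Q
    show ?thesis
    proof (cases "tempered_end c u")
      case True
      have "rmul (rmul_word c (Q # u) r) s =
          rmul_word c (Q # u) ((r - p * sec r) * s) + rmul_word c u (sec r * s)"
        using True by (simp only: rmul_word.simps letter.case if_True rmul_linear rmul_app Cons)
      \<comment> \<open>Absorption is read backwards: the absorbed part returns behind q as p (sec r
        s). Both summands are then products with the same word, and additivity in the argument joins
        them.\<close>
      also have "\<dots> = rmul_word c (Q # u) ((r - p * sec r) * s) + rmul_word c (Q # u) (p * (sec r * s))"
        by (simp only: rmul_word_Q_p[OF True])
      also have "\<dots> = rmul_word c (Q # u) (r * s)"
        by (simp only: rmul_word_add[symmetric]) (simp add: algebra_simps)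
      finally show ?thesis
        using Q by simp
    next
      case False
      then show ?thesis
        using Q by (simp add: rmul_app)
    qed
  qed
qed

lemma rmul_rmul: "rmul (rmul e r) s = rmul e (r * s)"
  unfolding rmul_def[of e] rmul_def[of "lin _ e"] lin_lin
  by (intro lin_cong) (auto simp: rmul_rmul_word simp flip: rmul_def)

text \<open>That a letter must follow q rules out the subwords (i) and (iii). The implication rules
  out (ii) and (iv) together, since \<open>tempered_end c v\<close> means that \<open>v\<close> ends
  in a letter of \<open>L\<close>, or is empty with \<open>c\<close> in C_+.\<close>

primrec reduced :: "'m \<Rightarrow> 'r letter list \<Rightarrow> bool" where
  "reduced c [] \<longleftrightarrow> c \<in> C"
| "reduced c (x # u) \<longleftrightarrow> reduced c u \<and> (case x of Q \<Rightarrow> True | Elt b \<Rightarrow>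
    b \<in> B \<and> (\<exists>v. u = Q # v \<and> (tempered_end c v \<longrightarrow> b \<notin> P)))"

text \<open>A forbidden subword that arises when a letter is appended is a suffix of the new word,
  so normality can be tested by recursion on the last letter.\<close>

lemma reduced_rev_iff: "(c, u) \<in> normal_words B L P C Cp \<longleftrightarrow> reduced c (rev u)"
proof (induction u rule: rev_induct)
  case Nil
  then show ?case
    by (auto simp: normal_words_def words_def)
next
  case (snoc x u)
  show ?case
  proof (cases x)
    case Q
    have "(c, u @ [Q]) \<in> normal_words B L P C Cp \<longleftrightarrow> (c, u) \<in> normal_words B L P C Cp"
      by (auto simp: normal_words_def words_def sublist_snoc)
    then show ?thesis
      using snoc Q by simp
  next
    case (Elt b)
    have 1: "suffix [Elt y, Elt z] (u @ [Elt b]) \<longleftrightarrow> z = b \<and> suffix [Elt y] u" for y z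
      using snoc_suffix_snoc[of "[Elt y]" "Elt z" u "Elt b"] by auto
    have 2: "suffix [Elt y, Q, Elt z] (u @ [Elt b]) \<longleftrightarrow> z = b \<and> suffix [Elt y, Q] u" for y z
      using snoc_suffix_snoc[of "[Elt y, Q]" "Elt z" u "Elt b"] by auto
    have *: "(c, u @ [Elt b]) \<in> normal_words B L P C Cp \<longleftrightarrow> (c, u) \<in> normal_words B L P C Cp \<and>
        b \<in> B \<and> u \<noteq> [] \<and> (\<forall>y\<in>B. \<not> suffix [Elt y] u) \<and>
        (b \<in> P \<longrightarrow> (\<forall>y\<in>L. \<not> suffix [Elt y, Q] u) \<and> (c \<in> Cp \<longrightarrow> u \<noteq> [Q]))"
      using P_subset
      by (auto simp: normal_words_def words_def sublist_snoc 1 2)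
    have "(c, u @ [Elt b]) \<in> normal_words B L P C Cp \<longleftrightarrow> reduced c (Elt b # rev u)"
    proof (cases u rule: rev_cases)
      case Nil
      then show ?thesis unfolding * by simp
    next
      case u: (snoc v y)
      show ?thesis
      proof (cases y)
        case Q
        show ?thesis
        proof (cases v rule: rev_cases)
          case Nil
          then show ?thesis
            unfolding * using snoc u Q by (auto simp: suffix_Cons)
        next
          case v: (snoc v' z)
          have u': "u = (v' @ [z]) @ [Q]"
            using u v Q by simp
          have s1: "suffix [Elt t] u \<longleftrightarrow> False" for t
            unfolding u' using snoc_suffix_snoc[of "[]" "Elt t" "v' @ [z]" Q] by simp
          have s2: "suffix [Elt t, Q] u \<longleftrightarrow> z = Elt t" for t
            unfolding u'
            using snoc_suffix_snoc[of "[Elt t]" Q "v' @ [z]" Q] snoc_suffix_snoc[of "[]" "Elt t" v' z]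
            by auto
          have rev_u: "rev u = Q # z # rev v'" "u \<noteq> []" "u \<noteq> [Q]"
            unfolding u' by simp_all
          show ?thesis
            unfolding * s1 s2 snoc using rev_u by (cases z) auto
        qed
      next
        case y: (Elt a)
        have "(c, u) \<in> normal_words B L P C Cp \<Longrightarrow> a \<in> B"
          using u y by (auto simp: normal_words_def words_def)
        then show ?thesis
          unfolding * using snoc u y by auto
      qed
    qed
    then show ?thesis
      using Elt by simp
  qed
qed

abbreviation "N \<equiv> normal_words B L P C Cp"

text \<open>Normal words with a tempered end. Their span contains every product w p with w normal,
  and q followed by p acts on it as the identity; these two facts give p q p = p.\<close>

abbreviation "Np \<equiv> {(c, u). reduced c (rev u) \<and> tempered_end c (rev u)}"

lemma N_eq: "N = {(c, u). reduced c (rev u)}"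
  using reduced_rev_iff by auto

section \<open>Stability of the span of the normal words\<close>

lemma keys_app: "S \<subseteq> insert 1 B \<Longrightarrow> r \<in> span S \<Longrightarrow>
    Poly_Mapping.keys (app c u r) \<subseteq> (\<lambda>b. (c, rev u @ Q # str b)) ` S"
  unfolding app_def using keys_rexp[of S r] by (intro keys_lin_subset) auto

lemma reduced_str:
  assumes "reduced c u" "b \<in> insert 1 B" "tempered_end c u \<Longrightarrow> b \<notin> P"
  shows "reduced c (rev (rev u @ Q # str b))"
  using assms by (auto simp: str_def)

lemma complement: "r - p * sec r \<in> span (insert 1 B - P)"
  by (rule complement_in_span) (simp_all add: span_B)

text \<open>After q behind a tempered end, only the part of r outside pR is appended, and its
  letters avoid \<open>P\<close>; behind any other end every letter of \<open>B\<close> may follow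
  q.\<close>

lemma keys_rmul_word: "reduced c u \<Longrightarrow> Poly_Mapping.keys (rmul_word c u r) \<subseteq> N"
proof (induction u arbitrary: r)
  case Nil
  then show ?case
    using keys_mexp[of C "act c r"] by (auto simp: span_C N_eq)
next
  case (Cons x u)
  then have u: "reduced c u" by simp
  show ?case
  proof (cases x)
    case (Elt b)
    then show ?thesis
      using Cons by simp
  next
    case Q
    show ?thesis
    proof (cases "tempered_end c u")
      case True
      have "Poly_Mapping.keys (app c u (r - p * sec r)) \<subseteq> N"
        using keys_app[OF _ complement, of c u r] reduced_str[OF u] by (auto simp: N_eq)
      then show ?thesis
        using Q True Cons.IH[OF u, of "sec r"] keys_add by fastforce
    next
      case False
      then show ?thesis
        using Q keys_app[of "insert 1 B" r c u] reduced_str[OF u] by (auto simp: N_eq span_B)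
    qed
  qed
qed

lemma rmul_word_Q_basis:
  assumes "b \<in> insert 1 B" "tempered_end c u \<Longrightarrow> b \<notin> P"
  shows "rmul_word c (Q # u) b = Poly_Mapping.single (c, rev u @ Q # str b) 1"
proof -
  have "rmul_word c u 0 = 0"
    using rmul_word_scale[of c u 0 0] by simp
  moreover have "app c u b = Poly_Mapping.single (c, rev u @ Q # str b) 1"
    using assms(1) by (simp add: app_def rexp_basis)
  ultimately show ?thesis
    using assms by (auto simp: sec_notin_P)
qed

lemma one_notin_P: "1 \<notin> P"
  using one_notin_B P_subset by blast

text \<open>In a normal word the last letter b stands after q, and either b is outside
  \<open>P\<close> or there is no tempered end before that q. So multiplying the shorter word by b
  appends b and absorbs nothing.\<close>

lemma rmul_word_one: "reduced c u \<Longrightarrow> rmul_word c u 1 = Poly_Mapping.single (c, rev u) 1"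
proof (induction u)
  case Nil
  then show ?case
    by (simp add: act_one mexp_basis)
next
  case (Cons x u)
  show ?case
  proof (cases x)
    case (Elt b)
    then obtain v where v: "u = Q # v" "b \<in> B" "tempered_end c v \<Longrightarrow> b \<notin> P"
      using Cons by auto
    then have "b \<noteq> 1"
      using one_notin_B by blast
    then show ?thesis
      using Elt v rmul_word_Q_basis[of b c v] by (simp add: str_def)
  next
    case Q
    then show ?thesis
      using rmul_word_Q_basis[of 1 c u] one_notin_P by (simp add: str_def)
  qed
qed

lemma keys_mexp_Mplus: "m \<in> Mplus \<Longrightarrow> Poly_Mapping.keys (mexp m) \<subseteq> Np"
proof -
  assume "m \<in> Mplus"
  then have "Poly_Mapping.keys (mexp m) \<subseteq> Cp \<times> {[]}"
    by (intro keys_mexp[OF Cp_subset]) (simp add: span_Cp)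
  also have "\<dots> \<subseteq> Np"
    using Cp_subset by auto
  finally show ?thesis .
qed

text \<open>The second alternative makes the induction go through. Multiplying a word ending in q by
  \<open>y\<close> in Rp passes the recursion on to \<open>sec y\<close>, which need not lie in Rp;
  what survives is that \<open>p * sec y\<close> does, and that the remaining word has a tempered
  end. For the empty string the two alternatives are the two closure properties of
  \<open>Mplus\<close>.\<close>

lemma keys_rmul_word_p:
  assumes "reduced c u" "y \<in> range (\<lambda>x. x * p) \<or> tempered_end c u \<and> p * y \<in> range (\<lambda>x. x * p)"
  shows "Poly_Mapping.keys (rmul_word c u y) \<subseteq> Np"
  using assms
proof (induction u arbitrary: y)
  case Nil
  have "act c y \<in> Mplus"
    using Nil(2)
  proof
    assume "y \<in> range (\<lambda>x. x * p)"
    then show ?thesis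
      using Mp_subset by (auto simp: act_mult)
  next
    assume "tempered_end c [] \<and> p * y \<in> range (\<lambda>x. x * p)"
    then show ?thesis
      using span_Cp M.span_superset[of Cp] by (intro mult_closed) auto
  qed
  then show ?case
    using keys_mexp_Mplus by simp
next
  case (Cons x u)
  then have u: "reduced c u" by simp
  show ?case
  proof (cases x)
    case (Elt b)
    have "b * y \<in> range (\<lambda>x. x * p)"
    proof (cases "y \<in> range (\<lambda>x. x * p)")
      case True
      then show ?thesis
        by (auto simp flip: mult.assoc)
    next
      case False
      \<comment> \<open>With b = z p and p y = t p one gets b y = (z t) p.\<close>
      then have "b \<in> range (\<lambda>x. x * p)" "p * y \<in> range (\<lambda>x. x * p)"
        using Cons(3) Elt span_L span_superset[of L] by auto
      then show ?thesis
        by (auto simp: mult.assoc) (auto simp flip: mult.assoc)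
    qed
    then show ?thesis
      using Elt Cons.IH[OF u] by simp
  next
    case Q
    \<comment> \<open>A final q is not a tempered end, which leaves the first alternative.\<close>
    then have y: "y \<in> range (\<lambda>x. x * p)"
      using Cons(3) by simp
    then have yL: "y \<in> span L"
      by (simp add: span_L)
    have L1: "L \<subseteq> insert 1 B"
      using L_subset by blast
    \<comment> \<open>An element of \<open>L\<close> differs from 1, so the string appended after q
      really ends in a letter of \<open>L\<close>.\<close>
    have end_str: "reduced c (rev (rev u @ Q # str b)) \<and> tempered_end c (rev (rev u @ Q # str b))"
      if "b \<in> L" "tempered_end c u \<Longrightarrow> b \<notin> P" for b
      using that L_subset one_notin_B reduced_str[OF u, of b] by (auto simp: str_def)
    show ?thesis
    proof (cases "tempered_end c u")
      case True
      have "Poly_Mapping.keys (app c u (y - p * sec y)) \<subseteq> Np"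
        using keys_app[OF _ complement_in_span[OF L1 yL], of c u] L1 end_str by fastforce
      moreover have "Poly_Mapping.keys (rmul_word c u (sec y)) \<subseteq> Np"
        using True p_sec_in_span_L[OF yL] by (intro Cons.IH[OF u]) simp
      ultimately show ?thesis
        using Q True keys_add[of "app c u (y - p * sec y)" "rmul_word c u (sec y)"] by auto
    next
      case False
      then show ?thesis
        using Q keys_app[OF L1 yL, of c u] end_str by fastforce
    qed
  qed
qed

lemma keys_rmul:
  assumes "Poly_Mapping.keys e \<subseteq> N"
  shows "Poly_Mapping.keys (rmul e r) \<subseteq> N"
  unfolding rmul_def
proof (intro keys_lin_subset)
  fix w assume "w \<in> Poly_Mapping.keys e"
  with assms have "reduced (fst w) (rev (snd w))"
    by (auto simp: N_eq)
  then show "Poly_Mapping.keys (case w of (c, u) \<Rightarrow> rmul_word c (rev u) r) \<subseteq> N"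
    by (cases w) (simp add: keys_rmul_word)
qed

lemma keys_rmul_p:
  assumes "Poly_Mapping.keys e \<subseteq> N"
  shows "Poly_Mapping.keys (rmul e p) \<subseteq> Np"
  unfolding rmul_def
proof (intro keys_lin_subset)
  fix w assume "w \<in> Poly_Mapping.keys e"
  with assms have "reduced (fst w) (rev (snd w))"
    by (auto simp: N_eq)
  moreover have "p \<in> range (\<lambda>x. x * p)"
    by (rule range_eqI[of _ _ 1]) simp
  ultimately show "Poly_Mapping.keys (case w of (c, u) \<Rightarrow> rmul_word c (rev u) p) \<subseteq> Np"
    using keys_rmul_word_p[of "fst w" "rev (snd w)" p] by (simp add: case_prod_beta)
qed

lemma rmul_one: "Poly_Mapping.keys e \<subseteq> N \<Longrightarrow> rmul e 1 = e"
proof -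
  assume e: "Poly_Mapping.keys e \<subseteq> N"
  have "rmul e 1 = lin (\<lambda>w. Poly_Mapping.single w 1) e"
    unfolding rmul_def using e by (intro lin_cong) (auto simp: rmul_word_one N_eq)
  then show ?thesis
    by simp
qed

section \<open>The action of the free algebra and the coordinate map\<close>

definition qmul :: "('m, 'r, 'k) mexpr \<Rightarrow> ('m, 'r, 'k) mexpr" where
  "qmul e = lin (\<lambda>(c, u). Poly_Mapping.single (c, u @ [Q]) 1) e"

lemma qmul_linear [simp]:
  "qmul (d + e) = qmul d + qmul e" "qmul 0 = 0" "qmul (smul a e) = smul a (qmul e)"
  "qmul (Poly_Mapping.single (c, u) a) = Poly_Mapping.single (c, u @ [Q]) a"
  by (simp_all add: qmul_def)

lemma keys_qmul: "Poly_Mapping.keys e \<subseteq> N \<Longrightarrow> Poly_Mapping.keys (qmul e) \<subseteq> N"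
  unfolding qmul_def by (intro keys_lin_subset) (auto simp: N_eq)

text \<open>This is absorption with y = 1, followed by the unit law on normal words.\<close>

lemma rmul_qmul_p: "Poly_Mapping.keys e \<subseteq> Np \<Longrightarrow> rmul (qmul e) p = e"
proof -
  assume e: "Poly_Mapping.keys e \<subseteq> Np"
  have "rmul (qmul e) p = lin (\<lambda>w. rmul (Poly_Mapping.single (fst w, snd w @ [Q]) 1) p) e"
    unfolding qmul_def rmul_def[of "lin _ _"] lin_lin
    by (intro lin_cong) auto
  also have "\<dots> = lin (\<lambda>w. Poly_Mapping.single w 1) e"
  proof (rule lin_cong)
    fix w assume "w \<in> Poly_Mapping.keys e"
    then obtain c u where w: "w = (c, u)" "reduced c (rev u)" "tempered_end c (rev u)"
      using e by auto
    then show "rmul (Poly_Mapping.single (fst w, snd w @ [Q]) 1) p = Poly_Mapping.single w 1"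
      using rmul_word_Q_p[of c "rev u" 1] by (simp add: rmul_word_one)
  qed
  finally show ?thesis
    by simp
qed

fun letter_mul :: "('m, 'r, 'k) mexpr \<Rightarrow> 'r letter \<Rightarrow> ('m, 'r, 'k) mexpr" where
  "letter_mul e (Elt r) = rmul e r"
| "letter_mul e Q = qmul e"

abbreviation "string_mul \<equiv> foldl letter_mul"

lemma letter_mul_linear [simp]:
  "letter_mul (d + e) x = letter_mul d x + letter_mul e x"
  "letter_mul (smul a e) x = smul a (letter_mul e x)"
  by (cases x; simp)+

lemma string_mul_linear [simp]:
  "string_mul (d + e) u = string_mul d u + string_mul e u"
  "string_mul (smul a e) u = smul a (string_mul e u)"
  by (induction u arbitrary: d e) auto

lemma keys_string_mul:
  "Poly_Mapping.keys e \<subseteq> N \<Longrightarrow> Poly_Mapping.keys (string_mul e u) \<subseteq> N"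
proof (induction u arbitrary: e)
  case (Cons x u)
  then show ?case
    by (cases x) (simp_all add: keys_rmul keys_qmul)
qed simp

definition free_mul :: "('m, 'r, 'k) mexpr \<Rightarrow> ('r, 'k) free \<Rightarrow> ('m, 'r, 'k) mexpr" where
  "free_mul e = lin (string_mul e)"

lemma free_mul_linear [simp]:
  "free_mul (d + e) f = free_mul d f + free_mul e f"
  "free_mul (smul a e) f = smul a (free_mul e f)"
  "free_mul e (f + g) = free_mul e f + free_mul e g"
  "free_mul e (f - g) = free_mul e f - free_mul e g"
  "free_mul e 0 = 0"
  "free_mul e (Poly_Mapping.single u a) = smul a (string_mul e u)"
proof -
  show "free_mul (d + e) f = free_mul d f + free_mul e f"
    unfolding free_mul_def lin_add_fun[symmetric] by (intro lin_cong) simp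
  show "free_mul (smul a e) f = smul a (free_mul e f)"
    unfolding free_mul_def lin_smul_fun[symmetric] by (intro lin_cong) simp
qed (simp_all add: free_mul_def)

lemma free_mul_zero [simp]: "free_mul 0 f = 0"
  using free_mul_linear(1)[of 0 0 f] by simp

lemma free_mul_mult: "free_mul e (f * g) = free_mul (free_mul e f) g"
proof (rule additive_eqI[of "\<lambda>f. free_mul e (f * g)" "\<lambda>f. free_mul (free_mul e f) g"])
  fix u a
  show "free_mul e (Poly_Mapping.single u a * g) = free_mul (free_mul e (Poly_Mapping.single u a)) g"
    by (rule additive_eqI[of "\<lambda>g. free_mul e (Poly_Mapping.single u a * g)"])
      (simp_all add: distrib_left mult_single plus_list_def foldl_append mult.commute)
qed (simp_all add: distrib_right)

lemma keys_free_mul: "Poly_Mapping.keys e \<subseteq> N \<Longrightarrow> Poly_Mapping.keys (free_mul e f) \<subseteq> N"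
  unfolding free_mul_def by (intro keys_lin_subset keys_string_mul)

lemma free_mul_one [simp]: "free_mul e 1 = e"
proof -
  have "free_mul e (Poly_Mapping.single [] 1) = e"
    by simp
  then show ?thesis
    by (simp flip: zero_list_def)
qed

lemma free_mul_gen [simp]: "free_mul e (gen x) = letter_mul e x"
  by (simp add: gen_def)

lemma free_mul_const [simp]: "free_mul e (const a) = smul a e"
  by (simp add: const_def)

text \<open>Expressions are restricted to the span of the normal words because the relations for 1
  and for p q p are verified only there; stability of this span makes the set a left ideal as well
  as a right one.\<close>

lemma ideal_annihilator:
  "ideal {f. \<forall>e. Poly_Mapping.keys e \<subseteq> N \<longrightarrow> free_mul e f = 0} ring_of_type_algebra"
  by (rule ideal_ring_of_type_algebraI) (auto simp: free_mul_mult keys_free_mul)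

lemma free_mul_adjoin_ideal:
  assumes "f \<in> adjoin_ideal scale p" "Poly_Mapping.keys e \<subseteq> N"
  shows "free_mul e f = 0"
proof -
  have "adjoin_rels scale p \<subseteq> {f. \<forall>e. Poly_Mapping.keys e \<subseteq> N \<longrightarrow> free_mul e f = 0}"
    unfolding adjoin_rels_def
    by (auto simp: free_mul_mult rmul_add_right rmul_scale_right rmul_rmul rmul_one rmul_qmul_p keys_rmul_p)
  then have "adjoin_ideal scale p \<subseteq> {f. \<forall>e. Poly_Mapping.keys e \<subseteq> N \<longrightarrow> free_mul e f = 0}"
    unfolding adjoin_ideal_def
    by (intro ring.genideal_minimal[OF ring_ring_of_type_algebra ideal_annihilator])
  then show ?thesis
    using assms by blast
qed

lemma keys_mexp_N: "Poly_Mapping.keys (mexp m) \<subseteq> N"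
  using keys_mexp[of C m] by (auto simp: span_C N_eq)

lemma string_mul_reduced:
  "(c, u) \<in> N \<Longrightarrow> string_mul (Poly_Mapping.single (c, []) 1) u = Poly_Mapping.single (c, u) 1"
proof (induction u rule: rev_induct)
  case (snoc x u)
  then have red: "reduced c (x # rev u)" "reduced c (rev u)"
    by (auto simp: N_eq)
  then have IH: "string_mul (Poly_Mapping.single (c, []) 1) u = Poly_Mapping.single (c, u) 1"
    by (intro snoc) (simp add: N_eq)
  show ?case
  proof (cases x)
    case (Elt b)
    \<comment> \<open>By definition a word ending in b times 1 is the shorter word times b, so the
      unit law gives the result.\<close>
    then have "rmul_word c (rev u) b = rmul_word c (x # rev u) 1"
      by simp
    also have "\<dots> = Poly_Mapping.single (c, u @ [x]) 1"
      using rmul_word_one[OF red(1)] by simp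
    finally show ?thesis
      using Elt by (simp add: IH)
  next
    case Q
    then show ?thesis by (simp add: IH)
  qed
qed simp

text \<open>The map sends m \<otimes> f to \<open>free_mul (mexp m) f\<close>. It reads off the
  coefficients of normal words, which is where their linear independence comes from.\<close>

lemma tempered_tensor_coordinates:
  obtains \<Phi> :: "_ \<Rightarrow> ('m, 'r, 'k) mexpr"
    where "\<And>s t. s \<in> carrier Ten \<Longrightarrow> t \<in> carrier Ten \<Longrightarrow> \<Phi> (s \<oplus>\<^bsub>Ten\<^esub> t) = \<Phi> s + \<Phi> t"
    and "\<And>c u a. (c, u) \<in> N \<Longrightarrow>
      \<Phi> (tens c (Poly_Mapping.single u a)) = Poly_Mapping.single (c, u) a"
proof (rule tempered_tensor_universal[of "\<lambda>n. smul (of_int n)" "\<lambda>m. free_mul (mexp m)"])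
  fix m r f
  show "free_mul (mexp (act m r)) f = free_mul (mexp m) (gen (Elt r) * f)"
    by (simp add: free_mul_mult rmul_mexp)
next
  fix m f assume m: "m \<in> Mplus"
  show "free_mul (mexp m) (gen Q * gen (Elt p) * f) = free_mul (mexp m) f"
    using rmul_qmul_p[OF keys_mexp_Mplus[OF m]] by (simp add: free_mul_mult)
next
  fix \<Phi> :: "_ \<Rightarrow> ('m, 'r, 'k) mexpr"
  assume \<Phi>: "\<And>s t. s \<in> carrier Ten \<Longrightarrow> t \<in> carrier Ten \<Longrightarrow> \<Phi> (s \<oplus>\<^bsub>Ten\<^esub> t) = \<Phi> s + \<Phi> t"
    "\<And>m f. \<Phi> (tens m f) = free_mul (mexp m) f"
  show thesis
  proof (rule that[of \<Phi>])
    fix c u and a :: 'k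
    assume N: "(c, u) \<in> N"
    then have "c \<in> C"
      by (auto simp: normal_words_def words_def)
    then show "\<Phi> (tens c (Poly_Mapping.single u a)) = Poly_Mapping.single (c, u) a"
      using string_mul_reduced[OF N] by (simp add: \<Phi> mexp_basis)
  qed (rule \<Phi>)
qed (simp_all add: smul.scale_left_distrib free_mul_adjoin_ideal keys_mexp_N)

end

text \<open>The single-word case is limited to the support of \<open>e\<close>, so that a hypothesis
  on that support stays available during the induction.\<close>

lemma poly_mapping_keys_induct [case_names zero single add]:
  fixes e :: "'a \<Rightarrow>\<^sub>0 'k::field"
  assumes "P 0" and "\<And>w a. w \<in> Poly_Mapping.keys e \<Longrightarrow> P (Poly_Mapping.single w a)"
    and "\<And>d d'. P d \<Longrightarrow> P d' \<Longrightarrow> P (d + d')"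
  shows "P e"
proof -
  have "P (\<Sum>w\<in>A. Poly_Mapping.single w (Poly_Mapping.lookup e w))" if "A \<subseteq> Poly_Mapping.keys e" for A
    using finite_subset[OF that] that
    by (induction A rule: infinite_finite_induct) (auto intro: assms)
  from this[OF subset_refl] show ?thesis
    using sum_single_eq_lin[of "\<lambda>w. w" e] by simp
qed

section \<open>Values of expressions\<close>

context p_tempered
begin

lemma cls_add_cong: "cls f = cls f' \<Longrightarrow> cls g = cls g' \<Longrightarrow> cls (f + g) = cls (f' + g')"
  by (metis adjoin_class_add)

lemma cls_mult_cong: "cls f = cls f' \<Longrightarrow> cls g = cls g' \<Longrightarrow> cls (f * g) = cls (f' * g')"
  by (metis adjoin_class_mult)

lemma cls_rel: "f - g \<in> adjoin_rels scale p \<Longrightarrow> cls f = cls g"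
  unfolding adjoin_class_eq_iff adjoin_ideal_def
  using ring.genideal_self[OF ring_ring_of_type_algebra, of "adjoin_rels scale p"] by auto

lemma cls_gen_add: "cls (gen (Elt (x + y))) = cls (gen (Elt x) + gen (Elt y))"
  by (rule cls_rel) (auto simp: adjoin_rels_def)

lemma cls_gen_scale: "cls (gen (Elt (scale a x))) = cls (const a * gen (Elt x))"
  by (rule cls_rel) (auto simp: adjoin_rels_def)

lemma cls_gen_mult: "cls (gen (Elt (x * y))) = cls (gen (Elt x) * gen (Elt y))"
  by (rule cls_rel) (auto simp: adjoin_rels_def)

lemma cls_gen_one: "cls (gen (Elt 1)) = cls 1"
  by (rule cls_rel) (auto simp: adjoin_rels_def)

lemma cls_gen_pqp: "cls (gen (Elt p) * gen Q * gen (Elt p)) = cls (gen (Elt p))"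
  by (rule cls_rel) (auto simp: adjoin_rels_def)

lemma tens_cls_cong: "cls f = cls g \<Longrightarrow> tens m f = tens m g"
  by (simp add: tens_def)

lemma const_mult: "const a * f = smul a f" "f * const a = smul a f"
proof -
  show "const a * f = smul a f"
    using mult_map_scale_conv_mult[of a f] by (simp add: const_def smul_def zero_list_def)
  show "f * const a = smul a f"
  proof (rule additive_eqI[of "\<lambda>f. f * const a" "smul a" f])
    show "Poly_Mapping.single u b * const a = smul a (Poly_Mapping.single u b)" for u b
      by (simp add: const_def mult_single plus_list_def mult.commute)
  qed (simp_all add: distrib_right smul.scale_right_distrib)
qed

lemma tens_zero_right: "tens m 0 = \<zero>\<^bsub>Ten\<^esub>"
proof -
  interpret operator_group Radj Ten by (rule operator_group_Ten)
  have "tens m 0 \<oplus>\<^bsub>Ten\<^esub> tens m 0 = tens m 0"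
    using tens_add_right[of m 0 0] by simp
  then show ?thesis
    by simp
qed

lemma tens_zero_left: "tens 0 f = \<zero>\<^bsub>Ten\<^esub>"
proof -
  interpret operator_group Radj Ten by (rule operator_group_Ten)
  have "tens 0 f \<oplus>\<^bsub>Ten\<^esub> tens 0 f = tens 0 f"
    using tens_add_left[of 0 0 f] by simp
  then show ?thesis
    by simp
qed

text \<open>The field acts on M through the elements a 1 of R, so \<open>a\<close> crosses the
  tensor sign and becomes a coefficient on the right.\<close>

lemma tens_module_scale: "tens (module_scale scale act a m) f = tens m (smul a f)"
proof -
  have "cls (gen (Elt (scale a 1)) * f) = cls (smul a f)"
    using cls_mult_cong[OF trans[OF cls_gen_scale cls_mult_cong[OF refl cls_gen_one]] refl, of a f]
    by (simp add: const_mult)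
  then show ?thesis
    unfolding module_scale_def tens_act by (rule tens_cls_cong)
qed

lemma tempered_scale_tens: "tempered_scale scale act p Mplus a (tens m f) = tens m (smul a f)"
  by (simp add: tempered_scale_def tens_smult const_mult)

lemma tempered_elt_eq: "tempered_elt scale act p Mplus m = tens m 1"
  by (simp add: tempered_elt_def extension_elt_def pure_tensor_def adjoin_class_one tens_def coset_def)

abbreviation mono :: "'r letter list \<Rightarrow> ('r, 'k) free" where
  "mono u \<equiv> Poly_Mapping.single u 1"

lemma mono_append: "mono (u @ v) = mono u * mono v"
  by (simp add: mult_single plus_list_def)

lemma mono_Nil: "mono [] = 1"
  by (simp flip: zero_list_def)

lemma mono_Cons: "mono (x # u) = gen x * mono u"
  by (simp add: gen_def mult_single plus_list_def)

abbreviation "wval \<equiv> word_value scale act p Mplus"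
abbreviation "val \<equiv> expr_value scale act p Mplus"

lemma word_value_eq: "wval (c, u) = tens c (mono u)"
proof (induction u rule: rev_induct)
  case Nil
  then show ?case
    by (simp add: word_value_def tempered_elt_eq mono_Nil)
next
  case (snoc x u)
  then have "wval (c, u @ [x]) = cls (gen x) \<odot>\<^bsub>Ten\<^esub> tens c (mono u)"
    by (simp add: word_value_def adjoin_letter_def)
  then show ?case
    by (simp add: tens_smult mono_append gen_def)
qed

definition term_value :: "('m, 'r, 'k) mexpr \<Rightarrow> ('m, 'r) mword \<Rightarrow> _" where
  "term_value e w = tens (fst w) (Poly_Mapping.single (snd w) (Poly_Mapping.lookup e w))"

text \<open>Allows the values of several expressions to be summed over one common set of words, as
  in \<open>val_add\<close>.\<close>

lemma expr_value_superset:
  assumes "finite A" "Poly_Mapping.keys e \<subseteq> A"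
  shows "val e = (\<Oplus>\<^bsub>Ten\<^esub>w\<in>A. term_value e w)"
proof -
  interpret operator_group Radj Ten by (rule operator_group_Ten)
  have "tempered_scale scale act p Mplus a (wval w) = tens (fst w) (Poly_Mapping.single (snd w) a)" for a w
    using word_value_eq[of "fst w" "snd w"] by (simp add: tempered_scale_tens)
  then show ?thesis
    unfolding expr_value_def using assms
    by (intro add.finprod_mono_neutral_cong_left)
      (auto simp: term_value_def in_keys_iff tens_zero_right)
qed

lemma val_in_carrier [simp]: "val e \<in> carrier Ten"
proof -
  interpret operator_group Radj Ten by (rule operator_group_Ten)
  show ?thesis
    using expr_value_superset[of "Poly_Mapping.keys e" e] by (auto simp: term_value_def intro!: finsum_closed)
qed

lemma val_single: "val (Poly_Mapping.single (c, u) a) = tens c (Poly_Mapping.single u a)"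
proof -
  interpret operator_group Radj Ten by (rule operator_group_Ten)
  show ?thesis
    using expr_value_superset[of "{(c, u)}" "Poly_Mapping.single (c, u) a"]
    by (simp add: term_value_def)
qed

lemma val_zero: "val 0 = \<zero>\<^bsub>Ten\<^esub>"
  using val_single[of 0 "[]" 0] by (simp add: tens_zero_right)

lemma val_add: "val (d + e) = val d \<oplus>\<^bsub>Ten\<^esub> val e"
proof -
  interpret operator_group Radj Ten by (rule operator_group_Ten)
  let ?A = "Poly_Mapping.keys d \<union> Poly_Mapping.keys e"
  have "val (d + e) = (\<Oplus>\<^bsub>Ten\<^esub>w\<in>?A. term_value (d + e) w)"
    by (rule expr_value_superset) (auto simp: keys_add)
  also have "\<dots> = (\<Oplus>\<^bsub>Ten\<^esub>w\<in>?A. term_value d w \<oplus>\<^bsub>Ten\<^esub> term_value e w)"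
    by (simp add: term_value_def lookup_add single_add tens_add_right)
  also have "\<dots> = (\<Oplus>\<^bsub>Ten\<^esub>w\<in>?A. term_value d w) \<oplus>\<^bsub>Ten\<^esub> (\<Oplus>\<^bsub>Ten\<^esub>w\<in>?A. term_value e w)"
    by (intro finsum_addf) (auto simp: term_value_def)
  also have "\<dots> = val d \<oplus>\<^bsub>Ten\<^esub> val e"
    by (simp flip: expr_value_superset)
  finally show ?thesis .
qed

lemma val_diff: "val (d - e) = val d \<ominus>\<^bsub>Ten\<^esub> val e"
proof -
  interpret operator_group Radj Ten by (rule operator_group_Ten)
  have "val d = val (d - e) \<oplus>\<^bsub>Ten\<^esub> val e"
    using val_add[of "d - e" e] by simp
  then show ?thesis
    by (simp add: a_minus_def add.m_assoc r_neg)
qed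

lemma val_sum: "finite A \<Longrightarrow> val (sum g A) = (\<Oplus>\<^bsub>Ten\<^esub>i\<in>A. val (g i))"
proof (induction A rule: finite_induct)
  case empty
  interpret operator_group Radj Ten by (rule operator_group_Ten)
  show ?case by (simp add: val_zero)
next
  case (insert x F)
  interpret operator_group Radj Ten by (rule operator_group_Ten)
  show ?case
    using insert by (simp add: val_add finsum_insert)
qed

lemma val_smul: "val (smul a e) = tempered_scale scale act p Mplus a (val e)"
proof (induction e rule: poly_mapping_keys_induct)
  case zero
  then show ?case
    using tempered_scale_tens[of a 0 0] by (simp add: val_zero tens_zero_right)
next
  case (single w b)
  then show ?case
    by (cases w) (simp add: val_single tempered_scale_tens)
next
  case (add d d')
  interpret operator_group Radj Ten by (rule operator_group_Ten)
  have "tempered_scale scale act p Mplus a (val d \<oplus>\<^bsub>Ten\<^esub> val d') =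
      tempered_scale scale act p Mplus a (val d) \<oplus>\<^bsub>Ten\<^esub> tempered_scale scale act p Mplus a (val d')"
    unfolding tempered_scale_def by (rule smult_add) auto
  then show ?case
    using add by (simp add: val_add smul.scale_right_distrib)
qed

text \<open>The argument of \<open>val\<close> is the outcome of replacing the subword between
  \<open>u\<close> and \<open>v\<close> by the expression \<open>f\<close>.\<close>

lemma val_string:
  "val (lin (\<lambda>z. Poly_Mapping.single (c, u @ z @ v) 1) f) = tens c (mono u * f * mono v)"
proof (induction f rule: poly_mapping_keys_induct)
  case zero
  then show ?case
    by (simp add: val_zero tens_zero_right)
next
  case (single z a)
  have "mono u * Poly_Mapping.single z a * mono v = Poly_Mapping.single (u @ z @ v) a"
    by (simp add: mult_single plus_list_def)
  then show ?case
    by (simp add: val_single)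
next
  case (add d d')
  then show ?case
    by (simp add: val_add tens_add_right distrib_left distrib_right)
qed

end

section \<open>The relations behind the reductions\<close>

context tempered_bases
begin

lemma cls_rexp: "cls (rexp r) = cls (gen (Elt r))"
proof -
  have "r \<in> span (insert 1 B)"
    by (simp add: span_B)
  then show ?thesis
  proof (induction rule: span_induct_alt)
    case base
    show ?case
      using cls_gen_scale[of 0 0] rexp_scale[of 0 0] by (simp add: const_mult)
  next
    case (step a x y)
    have "cls (mono (str x)) = cls (gen (Elt x))"
      by (auto simp: str_def gen_def mono_Nil cls_gen_one[unfolded gen_def])
    then have "cls (rexp (scale a x)) = cls (gen (Elt (scale a x)))"
      using cls_mult_cong[of "const a" "const a" "mono (str x)" "gen (Elt x)"] step(1)
      by (simp add: rexp_basis cls_gen_scale const_mult)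
    then have "cls (rexp (scale a x + y)) = cls (gen (Elt (scale a x)) + gen (Elt y))"
      unfolding rexp_add using step(2) by (rule cls_add_cong)
    then show ?case
      by (simp only: cls_gen_add)
  qed
qed

lemma val_M_expr:
  "val (lin (\<lambda>z. Poly_Mapping.single (z, v) 1) (M_expr scale act C m)) = tens m (mono v)"
proof -
  have exp: "M_expr scale act C (x + y) = M_expr scale act C x + M_expr scale act C y"
    "M_expr scale act C (module_scale scale act a x) = smul a (M_expr scale act C x)" for x y a
    unfolding M_expr_eq
    by (simp_all add: M.expansion_add[OF independent_C span_C] M.expansion_scale[OF independent_C span_C])
  have "m \<in> M.span C"
    by (simp add: span_C)
  then show ?thesis
  proof (induction rule: M.span_induct_alt)
    case base
    show ?case
      using exp(2)[of 0 0] by (simp add: val_zero tens_zero_left)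
  next
    case (step a x y)
    have "M_expr scale act C x = Poly_Mapping.single x 1"
      unfolding M_expr_eq by (rule M.expansion_basis[OF independent_C step(1)])
    then show ?case
      using step(2) by (simp add: exp val_add val_single tens_add_left tens_module_scale)
  qed
qed

lemma cls_string_reduction:
  assumes "string_reduction scale p B L P w f"
  shows "cls (mono w) = cls f"
  using assms
proof cases
  case (1 x y)
  have "cls (gen (Elt x) * gen (Elt y)) = cls (rexp (x * y))"
    by (simp add: cls_rexp cls_gen_mult)
  then show ?thesis
    using 1 by (simp add: mono_Cons mono_Nil rexp_def)
next
  case (2 x y)
  \<comment> \<open>Splitting x p and p y exposes the factor p q p, which the defining relation
    contracts to p.\<close>
  have "cls (gen (Elt (x * p)) * (gen Q * gen (Elt (p * y)))) =
      cls (gen (Elt x) * gen (Elt p) * (gen Q * (gen (Elt p) * gen (Elt y))))"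
    by (intro cls_mult_cong cls_gen_mult refl)
  also have "\<dots> = cls (gen (Elt x) * ((gen (Elt p) * gen Q * gen (Elt p)) * gen (Elt y)))"
    by (simp add: mult.assoc)
  also have "\<dots> = cls (gen (Elt x) * (gen (Elt p) * gen (Elt y)))"
    by (intro cls_mult_cong cls_gen_pqp refl)
  also have "\<dots> = cls (gen (Elt x) * gen (Elt p) * gen (Elt y))"
    by (simp add: mult.assoc)
  also have "\<dots> = cls (gen (Elt (x * p)) * gen (Elt y))"
    by (intro cls_mult_cong cls_gen_mult[symmetric] refl)
  also have "\<dots> = cls (gen (Elt (x * p * y)))"
    by (rule cls_gen_mult[symmetric])
  finally show ?thesis
    using 2 by (simp add: mono_Cons mono_Nil cls_rexp flip: rexp_def)
qed

abbreviation "reduces \<equiv> word_reduction scale act p B L P C Cp"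

lemma val_word_reduction:
  assumes "reduces w f"
  shows "wval w = val f"
  using assms
proof cases
  case (1 W g c u v)
  have "cls (mono u * mono W * mono v) = cls (mono u * g * mono v)"
    by (intro cls_mult_cong refl cls_string_reduction 1)
  from tens_cls_cong[OF this, of c] have "tens c (mono (u @ W @ v)) = tens c (mono u * g * mono v)"
    by (simp only: mono_append mult.assoc)
  then show ?thesis
    unfolding 1 sum_single_eq_lin val_string word_value_eq .
next
  case (2 c W g v)
  from 2(3) have "tens c (mono (W @ v)) = val (lin (\<lambda>z. Poly_Mapping.single (z, v) 1) g)"
  proof cases
    case (1 y)
    then show ?thesis
      by (simp add: val_M_expr tens_act mono_Cons)
  next
    case (2 y)
    then have "c \<in> Mplus"
      using span_Cp M.span_superset[of Cp] by auto
    \<comment> \<open>The tempered relation, read backwards, inserts q p between c and y.\<close>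
    then have "tens (act c y) (mono v) = tens c (gen Q * gen (Elt p) * (gen (Elt y) * mono v))"
      by (simp add: tens_act tens_tempered)
    also have "\<dots> = tens c (gen Q * (gen (Elt p) * gen (Elt y) * mono v))"
      by (simp add: mult.assoc)
    also have "\<dots> = tens c (gen Q * (gen (Elt (p * y)) * mono v))"
      by (intro tens_cls_cong cls_mult_cong refl cls_gen_mult[symmetric])
    finally show ?thesis
      using 2 by (simp add: val_M_expr mono_Cons)
  qed
  then show ?thesis
    unfolding 2 sum_single_eq_lin word_value_eq .
qed

end

section \<open>Termination and irreducible expressions\<close>

context tempered_bases
begin

abbreviation "step \<equiv> expr_reduction scale act p B L P C Cp"

text \<open>An element of R expands into strings of length at most one, while the replaced strings
  have length two or three.\<close>

lemma keys_string_reduction: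
  "string_reduction scale p B L P w f \<Longrightarrow> z \<in> Poly_Mapping.keys f \<Longrightarrow>
    set z \<subseteq> Elt ` B \<and> length z < length w"
proof (induction rule: string_reduction.induct)
  case (1 x y)
  then show ?case
    using keys_rexp[of "insert 1 B" "x * y"] by (auto simp: span_B str_def simp flip: rexp_def split: if_splits)
next
  case (2 x y)
  then show ?case
    using keys_rexp[of "insert 1 B" "x * p * y"] by (auto simp: span_B str_def simp flip: rexp_def split: if_splits)
qed

lemma keys_M_expr: "Poly_Mapping.keys (M_expr scale act C m) \<subseteq> C"
  using M.keys_expansion[OF independent_C subset_refl, of m "\<lambda>c. c"] by (simp add: M_expr_eq span_C)

lemma keys_head_reduction:
  "head_reduction scale act p B P C Cp w f \<Longrightarrow> Poly_Mapping.keys f \<subseteq> C \<and> snd w \<noteq> []"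
  by (induction rule: head_reduction.induct) (simp_all add: keys_M_expr)

lemma keys_word_reduction:
  assumes "reduces w f" "z \<in> Poly_Mapping.keys f"
  shows "length (snd z) < length (snd w)" "w \<in> words B C \<Longrightarrow> z \<in> words B C"
proof -
  have "length (snd z) < length (snd w) \<and> (w \<in> words B C \<longrightarrow> z \<in> words B C)"
    using assms(1)
  proof cases
    case (1 W g c u v)
    have "Poly_Mapping.keys f \<subseteq> (\<Union>y\<in>Poly_Mapping.keys g. {(c, u @ y @ v)})"
      unfolding 1 sum_single_eq_lin by (rule order.trans[OF keys_lin]) auto
    then obtain y where "y \<in> Poly_Mapping.keys g" "z = (c, u @ y @ v)"
      using assms(2) by blast
    then show ?thesis
      using keys_string_reduction[OF 1(3)] 1(1) by (auto simp: words_def)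
  next
    case (2 c W g v)
    have "Poly_Mapping.keys f \<subseteq> (\<Union>y\<in>Poly_Mapping.keys g. {(y, v)})"
      unfolding 2 sum_single_eq_lin by (rule order.trans[OF keys_lin]) auto
    then obtain y where "y \<in> Poly_Mapping.keys g" "z = (y, v)"
      using assms(2) by blast
    then show ?thesis
      using keys_head_reduction[OF 2(3)] 2(1) by (auto simp: words_def)
  qed
  then show "length (snd z) < length (snd w)" "w \<in> words B C \<Longrightarrow> z \<in> words B C"
    by blast+
qed

lemma reduces_if_not_normal:
  assumes "(c, u) \<in> words B C" "(c, u) \<notin> N"
  shows "\<exists>f. reduces (c, u) f"
proof -
  consider x y where "x \<in> B" "y \<in> B" "sublist [Elt x, Elt y] u"
    | x y where "x \<in> L" "y \<in> P" "sublist [Elt x, Q, Elt y] u"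
    | y where "y \<in> B" "prefix [Elt y] u"
    | y where "c \<in> Cp" "y \<in> P" "prefix [Q, Elt y] u"
    using assms by (auto simp: normal_words_def)
  then show ?thesis
  proof cases
    case 1
    from 1(3) obtain ps ss where u: "u = ps @ [Elt x, Elt y] @ ss"
      by (auto simp: sublist_def)
    show ?thesis
      unfolding u using word_reduction.intros(1) string_reduction.intros(1)[OF 1(1,2)] by blast
  next
    case 2
    from 2(3) obtain ps ss where u: "u = ps @ [Elt x, Q, Elt y] @ ss"
      by (auto simp: sublist_def)
    \<comment> \<open>The rules are indexed by factorizations of the letters, so a factor has to be
      chosen for each of the two.\<close>
    obtain x' where x': "x = x' * p"
      using 2(1) span_L span_superset[of L] by blast
    obtain y' where y': "y = p * y'"
      using 2(2) span_P span_superset[of P] by blast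
    show ?thesis
      unfolding u x' y'
      using word_reduction.intros(1) string_reduction.intros(2)[OF 2(1)[unfolded x'] 2(2)[unfolded y']]
      by blast
  next
    case 3
    from 3(2) obtain v where u: "u = [Elt y] @ v"
      by (auto simp: prefix_def)
    have "c \<in> C"
      using assms(1) by (simp add: words_def)
    then show ?thesis
      unfolding u using word_reduction.intros(2) head_reduction.intros(1)[OF _ 3(1)] by blast
  next
    case 4
    from 4(3) obtain v where u: "u = [Q, Elt y] @ v"
      by (auto simp: prefix_def)
    obtain y' where y': "y = p * y'"
      using 4(2) span_P span_superset[of P] by blast
    show ?thesis
      unfolding u y'
      using word_reduction.intros(2) head_reduction.intros(2)[OF 4(1) 4(2)[unfolded y']] by blast
  qed
qed

lemma stepE:
  assumes "step e e'"
  obtains w f where "w \<in> Poly_Mapping.keys e" "reduces w f"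
    "e' = e - Poly_Mapping.single w (Poly_Mapping.lookup e w) + smul (Poly_Mapping.lookup e w) f"
  using assms unfolding expr_reduction_def smul_def[symmetric] by blast

lemma keys_step:
  assumes "e' = e - Poly_Mapping.single w (Poly_Mapping.lookup e w) + smul a f"
  shows "Poly_Mapping.keys e' \<subseteq> (Poly_Mapping.keys e - {w}) \<union> Poly_Mapping.keys f"
proof
  fix z assume "z \<in> Poly_Mapping.keys e'"
  then show "z \<in> (Poly_Mapping.keys e - {w}) \<union> Poly_Mapping.keys f"
    unfolding assms by (auto simp: in_keys_iff lookup_add lookup_minus lookup_single when_def split: if_splits)
qed

lemma step_words: "step e e' \<Longrightarrow> Poly_Mapping.keys e \<subseteq> words B C \<Longrightarrow> Poly_Mapping.keys e' \<subseteq> words B C"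
proof (elim stepE)
  fix w f
  assume *: "Poly_Mapping.keys e \<subseteq> words B C" "w \<in> Poly_Mapping.keys e" "reduces w f"
    "e' = e - Poly_Mapping.single w (Poly_Mapping.lookup e w) + smul (Poly_Mapping.lookup e w) f"
  then show "Poly_Mapping.keys e' \<subseteq> words B C"
    using keys_step[OF *(4)] keys_word_reduction(2)[OF *(3)] by blast
qed

lemma step_val: "step e e' \<Longrightarrow> val e' = val e"
proof (elim stepE)
  fix w f
  let ?a = "Poly_Mapping.lookup e w"
  assume *: "w \<in> Poly_Mapping.keys e" "reduces w f" "e' = e - Poly_Mapping.single w ?a + smul ?a f"
  have "wval w = val (Poly_Mapping.single w 1)"
    by (cases w) (simp add: word_value_eq val_single)
  then have "val (smul ?a f) = val (smul ?a (Poly_Mapping.single w 1))"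
    using val_word_reduction[OF *(2)] by (simp only: val_smul)
  then have "val e' = val ((e - Poly_Mapping.single w ?a) + Poly_Mapping.single w ?a)"
    unfolding *(3) val_add by simp
  then show "val e' = val e"
    by simp
qed

text \<open>A step trades one word for possibly several shorter ones, so neither the number of words
  nor the total length need drop. The multiset of lengths does decrease in the multiset
  order.\<close>

definition lengths :: "('m, 'r, 'k) mexpr \<Rightarrow> nat multiset" where
  "lengths e = image_mset (\<lambda>w. length (snd w)) (mset_set (Poly_Mapping.keys e))"

lemma step_lengths:
  assumes "step e e'"
  shows "(lengths e', lengths e) \<in> mult less_than"
proof -
  obtain w f where *: "w \<in> Poly_Mapping.keys e" "reduces w f"
    "e' = e - Poly_Mapping.single w (Poly_Mapping.lookup e w) + smul (Poly_Mapping.lookup e w) f"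
    using assms by (rule stepE)
  let ?K = "Poly_Mapping.keys e" and ?K' = "Poly_Mapping.keys e'"
  let ?l = "\<lambda>D. image_mset (\<lambda>w. length (snd w)) (mset_set D)"
  have sub: "?K' \<subseteq> (?K - {w}) \<union> Poly_Mapping.keys f"
    by (rule keys_step[OF *(3)])
  \<comment> \<open>\<open>?K' \<inter> (?K - {w})\<close> holds the old words that survive the
    step. Cancellation against \<open>f\<close> may remove words besides \<open>w\<close>; these
    only enlarge the part of the old multiset that is given up.\<close>
  have "lengths e' = ?l ((?K' \<inter> (?K - {w})) \<union> (?K' - (?K - {w})))"
    unfolding lengths_def by (simp add: Un_Diff_Int Int_commute Un_commute)
  then have 1: "lengths e' = ?l (?K' \<inter> (?K - {w})) + ?l (?K' - (?K - {w}))"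
    by (subst (asm) mset_set_Union) auto
  have "lengths e = ?l ((?K' \<inter> (?K - {w})) \<union> (?K - ?K' \<inter> (?K - {w})))"
    unfolding lengths_def by (rule arg_cong[of _ _ ?l]) auto
  then have 2: "lengths e = ?l (?K' \<inter> (?K - {w})) + ?l (?K - ?K' \<inter> (?K - {w}))"
    by (subst (asm) mset_set_Union) auto
  show ?thesis
    unfolding 1 2
  proof (rule one_step_implies_mult)
    have w: "w \<in> ?K - ?K' \<inter> (?K - {w})"
      using *(1) by auto
    then show "?l (?K - ?K' \<inter> (?K - {w})) \<noteq> {#}"
      by (auto simp: mset_set_empty_iff)
    have len_w: "length (snd w) \<in># ?l (?K - ?K' \<inter> (?K - {w}))"
      using w by (simp add: image_iff) blast
    have less: "n < length (snd w)" if "n \<in># ?l (?K' - (?K - {w}))" for n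
      using that sub keys_word_reduction(1)[OF *(2)] by auto
    show "\<forall>k\<in>set_mset (?l (?K' - (?K - {w}))).
        \<exists>j\<in>set_mset (?l (?K - ?K' \<inter> (?K - {w}))). (k, j) \<in> less_than"
      using less by (intro ballI bexI[OF _ len_w]) (simp only: less_than_iff)
  qed
qed

lemma wf_step: "wf {(e', e). step e e'}"
  by (rule wf_subset[OF wf_inv_image[OF wf_mult[OF wf_less_than], of lengths]])
    (auto simp: step_lengths)

lemma no_infinite_reduction: "\<not> (\<exists>s. s 0 = e \<and> (\<forall>i. step (s i) (s (Suc i))))"
  using wf_step unfolding wf_iff_no_infinite_down_chain by auto

lemma steps_invariant:
  assumes "step\<^sup>*\<^sup>* e g" "Poly_Mapping.keys e \<subseteq> words B C"
  shows "Poly_Mapping.keys g \<subseteq> words B C" "val g = val e"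
  using assms by (induction rule: rtranclp_induct) (auto simp: step_val dest: step_words)

lemma irreducible_normal:
  assumes "Poly_Mapping.keys g \<subseteq> words B C" "\<not> (\<exists>h. step g h)"
  shows "Poly_Mapping.keys g \<subseteq> N"
proof
  fix w assume w: "w \<in> Poly_Mapping.keys g"
  show "w \<in> N"
  proof (rule ccontr)
    assume "w \<notin> N"
    then obtain f where "reduces w f"
      using reduces_if_not_normal[of "fst w" "snd w"] assms(1) w by auto
    then show False
      using assms(2) w unfolding expr_reduction_def by blast
  qed
qed

lemma normal_form_exists:
  assumes "Poly_Mapping.keys e \<subseteq> words B C"
  obtains g where "Poly_Mapping.keys g \<subseteq> N" "val g = val e"
proof -
  have "\<exists>g. step\<^sup>*\<^sup>* e g \<and> \<not> (\<exists>h. step g h)"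
    by (induction e rule: wf_induct_rule[OF wf_step])
      (metis (mono_tags, lifting) case_prodI converse_rtranclp_into_rtranclp mem_Collect_eq rtranclp.rtrancl_refl)
  then show thesis
    using that steps_invariant[OF _ assms] irreducible_normal by blast
qed

section \<open>The normal words as a basis\<close>

lemma N_subset_words: "N \<subseteq> words B C"
  by (auto simp: normal_words_def)

text \<open>The coordinate map is a left inverse of \<open>val\<close> on expressions supported in
  the normal words.\<close>

lemma val_inj:
  assumes "Poly_Mapping.keys d \<subseteq> N" "Poly_Mapping.keys e \<subseteq> N" "val d = val e"
  shows "d = e"
proof -
  obtain \<Phi> :: "_ \<Rightarrow> ('m, 'r, 'k) mexpr"
    where add: "\<And>s t. s \<in> carrier Ten \<Longrightarrow> t \<in> carrier Ten \<Longrightarrow> \<Phi> (s \<oplus>\<^bsub>Ten\<^esub> t) = \<Phi> s + \<Phi> t"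
    and tens: "\<And>c u a. (c, u) \<in> N \<Longrightarrow>
      \<Phi> (tens c (Poly_Mapping.single u a)) = Poly_Mapping.single (c, u) a"
    by (rule tempered_tensor_coordinates) blast
  have "\<Phi> (val e) = e" if e: "Poly_Mapping.keys e \<subseteq> N" for e
  proof (induction e rule: poly_mapping_keys_induct)
    case zero
    have "\<Phi> (val 0 \<oplus>\<^bsub>Ten\<^esub> val 0) = \<Phi> (val 0) + \<Phi> (val 0)"
      by (rule add) simp_all
    then show ?case
      by (simp flip: val_add)
  next
    case (single w a)
    then show ?case
      using e tens[of "fst w" "snd w" a] val_single[of "fst w" "snd w" a] by auto
  next
    case (add d d')
    then show ?case
      by (simp add: val_add \<open>\<And>s t. _ \<Longrightarrow> _ \<Longrightarrow> \<Phi> (s \<oplus>\<^bsub>Ten\<^esub> t) = \<Phi> s + \<Phi> t\<close>)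
  qed
  then show ?thesis
    using assms by metis
qed

definition spanned :: "_ set" where
  "spanned = {val e | e. Poly_Mapping.keys e \<subseteq> words B C}"

lemma spanned_val: "Poly_Mapping.keys e \<subseteq> words B C \<Longrightarrow> val e \<in> spanned"
  by (auto simp: spanned_def)

lemma spanned_add: "s \<in> spanned \<Longrightarrow> t \<in> spanned \<Longrightarrow> s \<oplus>\<^bsub>Ten\<^esub> t \<in> spanned"
  unfolding spanned_def mem_Collect_eq using keys_add val_add by (metis (no_types, lifting) Un_least subset_trans)

lemma spanned_diff: "s \<in> spanned \<Longrightarrow> t \<in> spanned \<Longrightarrow> s \<ominus>\<^bsub>Ten\<^esub> t \<in> spanned"
  unfolding spanned_def mem_Collect_eq using keys_diff val_diff by (metis (no_types, lifting) Un_least subset_trans)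

text \<open>The free algebra has a letter for every element of R, whereas words use only letters
  from \<open>B\<close>; an appended letter r is therefore replaced by its expansion
  \<open>rexp r\<close>.\<close>

lemma spanned_letter:
  assumes "t \<in> spanned"
  shows "cls (gen x) \<odot>\<^bsub>Ten\<^esub> t \<in> spanned"
proof -
  interpret T: operator_group Radj Ten by (rule operator_group_Ten)
  obtain e where e: "t = val e" "Poly_Mapping.keys e \<subseteq> words B C"
    using assms by (auto simp: spanned_def)
  have "cls (gen x) \<odot>\<^bsub>Ten\<^esub> val e \<in> spanned"
  proof (induction e rule: poly_mapping_keys_induct)
    case zero
    show ?case
      using spanned_val[of 0] T.smult_zero[of "cls (gen x)"] by (simp add: val_zero)
  next
    case (single w a)
    obtain c u where w: "w = (c, u)" by (cases w)
    have cu: "c \<in> C" "set u \<subseteq> insert Q (Elt ` B)"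
      using single e(2) w by (auto simp: words_def)
    have eq: "cls (gen x) \<odot>\<^bsub>Ten\<^esub> val (Poly_Mapping.single w a) = tens c (mono u * smul a (gen x) * mono [])"
      by (simp add: w val_single tens_smult gen_def mult_single plus_list_def mono_Nil)
    show ?case
    proof (cases x)
      case Q
      have "val (Poly_Mapping.single (c, u @ [Q]) a) \<in> spanned"
        using cu by (intro spanned_val) (auto simp: words_def)
      then show ?thesis
        unfolding eq using Q by (simp add: val_single gen_def mult_single plus_list_def mono_Nil)
    next
      case (Elt r)
      have "cls (smul a (gen x)) = cls (smul a (rexp r))"
        using cls_mult_cong[OF refl cls_rexp[symmetric], of "const a" r] Elt by (simp add: const_mult)
      then have "tens c (mono u * smul a (gen x) * mono []) = tens c (mono u * smul a (rexp r) * mono [])"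
        by (intro tens_cls_cong cls_mult_cong refl)
      also have "\<dots> = val (lin (\<lambda>z. Poly_Mapping.single (c, u @ z @ []) 1) (smul a (rexp r)))"
        by (rule val_string[symmetric])
      also have "\<dots> \<in> spanned"
      proof (intro spanned_val keys_lin_subset)
        fix z assume "z \<in> Poly_Mapping.keys (smul a (rexp r))"
        then have "set z \<subseteq> Elt ` B"
          using keys_smul[of a "rexp r"] keys_rexp[of "insert 1 B" r]
          by (auto simp: span_B str_def split: if_splits)
        then show "Poly_Mapping.keys (Poly_Mapping.single (c, u @ z @ []) (1 :: 'k)) \<subseteq> words B C"
          using cu by (auto simp: words_def)
      qed
      finally show ?thesis
        unfolding eq .
    qed
  next
    case (add d d')
    then show ?case
      by (simp add: val_add T.smult_add spanned_add)
  qed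
  then show ?thesis
    by (simp add: e)
qed

lemma spanned_tens: "tens m f \<in> spanned"
proof (induction f rule: poly_mapping_keys_induct)
  case zero
  then show ?case
    using spanned_val[of 0] by (simp add: val_zero tens_zero_right)
next
  case (single u a)
  show ?case
  proof (induction u rule: rev_induct)
    case Nil
    have "tens m (Poly_Mapping.single [] a) = tens (module_scale scale act a m) (mono [])"
      by (simp add: tens_module_scale)
    also have "\<dots> = val (mexp (module_scale scale act a m))"
      unfolding mexp_def val_M_expr ..
    also have "\<dots> \<in> spanned"
      by (intro spanned_val order.trans[OF keys_mexp_N N_subset_words])
    finally show ?case .
  next
    case (snoc x u)
    then show ?case
      using spanned_letter[OF snoc, of x] by (simp add: tens_smult gen_def mult_single plus_list_def)
  qed
next
  case (add d d')
  then show ?case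
    by (simp add: tens_add_right spanned_add)
qed

lemma carrier_spanned:
  assumes "t \<in> carrier Ten"
  obtains e where "Poly_Mapping.keys e \<subseteq> N" "t = val e"
proof -
  from assms have "t \<in> spanned"
    by (induction rule: Ten_induct) (simp_all add: spanned_tens spanned_diff)
  then show thesis
    using that normal_form_exists by (auto simp: spanned_def) metis
qed

lemma inj_word_value: "inj_on wval N"
proof (rule inj_onI)
  fix v w assume vw: "v \<in> N" "w \<in> N" "wval v = wval w"
  have "val (Poly_Mapping.single v 1) = val (Poly_Mapping.single w 1)"
    using vw(3) by (cases v; cases w) (simp add: val_single word_value_eq)
  then have "Poly_Mapping.single v (1 :: 'k) = Poly_Mapping.single w 1"
    using vw by (intro val_inj) auto
  then show "v = w"
    using keys_single[of v "1 :: 'k"] by simp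
qed

lemma tempered_basis_normal_words: "tempered_basis scale act p Mplus (wval ` N)"
  unfolding tempered_basis_def Let_def
proof (intro conjI ballI)
  show "wval ` N \<subseteq> carrier Ten"
    using word_value_eq by fastforce
next
  interpret T: operator_group Radj Ten by (rule operator_group_Ten)
  fix t assume "t \<in> carrier Ten"
  then obtain e where e: "Poly_Mapping.keys e \<subseteq> N" "t = val e"
    by (rule carrier_spanned)
  \<comment> \<open>Coefficients are indexed by values in \<open>tempered_basis\<close> and by words
    in \<open>val_inj\<close>; \<open>enc\<close> translates between the two.\<close>
  define enc where "enc = inv_into N wval"
  have enc: "enc (wval w) = w" if "w \<in> N" for w
    unfolding enc_def using inj_word_value that by simp
  have dec: "wval (enc b) = b" "enc b \<in> N" if "b \<in> wval ` N" for b
    using that by (auto simp: enc)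
  let ?to = "lin (\<lambda>b. Poly_Mapping.single (enc b) 1) :: (_ \<Rightarrow>\<^sub>0 'k) \<Rightarrow> _"
  let ?from = "lin (\<lambda>w. Poly_Mapping.single (wval w) 1) :: (_ \<Rightarrow>\<^sub>0 'k) \<Rightarrow> _"
  have sum: "(\<Oplus>\<^bsub>Ten\<^esub>b\<in>Poly_Mapping.keys f. tempered_scale scale act p Mplus (Poly_Mapping.lookup f b) b) =
      val (?to f)" if "Poly_Mapping.keys f \<subseteq> wval ` N" for f :: "_ \<Rightarrow>\<^sub>0 'k"
  proof -
    have *: "val (Poly_Mapping.single (enc b) a) = tempered_scale scale act p Mplus a b"
      if "b \<in> wval ` N" for a b
    proof -
      have "val (Poly_Mapping.single (enc b) a) = val (smul a (Poly_Mapping.single (enc b) 1))"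
        by simp
      also have "\<dots> = tempered_scale scale act p Mplus a (wval (enc b))"
        unfolding val_smul by (cases "enc b") (simp add: val_single word_value_eq)
      finally show ?thesis
        by (simp add: dec that)
    qed
    have "val (?to f) = (\<Oplus>\<^bsub>Ten\<^esub>b\<in>Poly_Mapping.keys f. val (Poly_Mapping.single (enc b) (Poly_Mapping.lookup f b)))"
      by (simp add: lin_def val_sum)
    also have "\<dots> = (\<Oplus>\<^bsub>Ten\<^esub>b\<in>Poly_Mapping.keys f. tempered_scale scale act p Mplus (Poly_Mapping.lookup f b) b)"
      using that by (intro T.finsum_cong') (auto simp flip: *)
    finally show ?thesis ..
  qed
  have keys_to: "Poly_Mapping.keys (?to f) \<subseteq> N" if "Poly_Mapping.keys f \<subseteq> wval ` N" for f
    using that dec by (intro keys_lin_subset) auto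
  have from_to: "?from (?to f) = f" if "Poly_Mapping.keys f \<subseteq> wval ` N" for f :: "_ \<Rightarrow>\<^sub>0 'k"
  proof -
    have "?from (?to f) = lin (\<lambda>b. Poly_Mapping.single b 1) f"
      unfolding lin_lin using that dec by (intro lin_cong) auto
    then show ?thesis by simp
  qed
  have to_from: "?to (?from e) = e"
  proof -
    have "?to (?from e) = lin (\<lambda>w. Poly_Mapping.single w 1) e"
      unfolding lin_lin using e(1) enc by (intro lin_cong) auto
    then show ?thesis by simp
  qed
  have keys_from: "Poly_Mapping.keys (?from e) \<subseteq> wval ` N"
    using e(1) by (intro keys_lin_subset) auto
  show "\<exists>!f :: _ \<Rightarrow>\<^sub>0 'k. Poly_Mapping.keys f \<subseteq> wval ` N \<and>
      t = (\<Oplus>\<^bsub>Ten\<^esub>b\<in>Poly_Mapping.keys f. tempered_scale scale act p Mplus (Poly_Mapping.lookup f b) b)"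
  proof (rule ex1I[of _ "?from e"])
    show "Poly_Mapping.keys (?from e) \<subseteq> wval ` N \<and>
        t = (\<Oplus>\<^bsub>Ten\<^esub>b\<in>Poly_Mapping.keys (?from e).
          tempered_scale scale act p Mplus (Poly_Mapping.lookup (?from e) b) b)"
      using keys_from e(2) by (simp add: sum to_from)
  next
    fix f :: "_ \<Rightarrow>\<^sub>0 'k"
    assume f: "Poly_Mapping.keys f \<subseteq> wval ` N \<and>
        t = (\<Oplus>\<^bsub>Ten\<^esub>b\<in>Poly_Mapping.keys f. tempered_scale scale act p Mplus (Poly_Mapping.lookup f b) b)"
    then have "val (?to f) = val e"
      using e(2) by (simp add: sum)
    then have "?to f = e"
      using f e(1) by (intro val_inj keys_to) auto
    then show "f = ?from e"
      using from_to[of f] f by simp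
  qed
qed

end

section \<open>Bases of the algebra\<close>

context k_algebra
begin

lemma subspace_right_ideal: "subspace (range (\<lambda>x. p * x))"
proof (rule subspaceI)
  show "0 \<in> range (\<lambda>x. p * x)"
    by (rule range_eqI[of _ _ 0]) simp
  show "x + y \<in> range (\<lambda>x. p * x)" if "x \<in> range (\<lambda>x. p * x)" "y \<in> range (\<lambda>x. p * x)" for x y
    using that by (auto simp flip: distrib_left)
  show "scale c x \<in> range (\<lambda>x. p * x)" if "x \<in> range (\<lambda>x. p * x)" for c x
    using that by (auto simp flip: mult_scale_right)
qed

lemma subspace_left_ideal: "subspace (range (\<lambda>x. x * p))"
proof (rule subspaceI)
  show "0 \<in> range (\<lambda>x. x * p)"
    by (rule range_eqI[of _ _ 0]) simp
  show "x + y \<in> range (\<lambda>x. x * p)" if "x \<in> range (\<lambda>x. x * p)" "y \<in> range (\<lambda>x. x * p)" for x y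
    using that by (auto simp flip: distrib_right)
  show "scale c x \<in> range (\<lambda>x. x * p)" if "x \<in> range (\<lambda>x. x * p)" for c x
    using that by (auto simp flip: mult_scale_left)
qed

text \<open>The basis is built up along pR \<inter> Rp, Rp, pR + Rp, pR + Rp + k and R, one piece at
  a time; at each stage the span of the new piece meets the span of the old ones in 0.\<close>

lemma algebra_basis:
  assumes one: "1 \<notin> {p * x + y * p | x y. True}"
    and Bpp: "k_basis scale (range (\<lambda>x. p * x) \<inter> range (\<lambda>x. x * p)) Bpp"
    and Bpm: "relative_basis scale (range (\<lambda>x. p * x)) (range (\<lambda>x. p * x) \<inter> range (\<lambda>x. x * p)) Bpm"
    and Bmp: "relative_basis scale (range (\<lambda>x. x * p)) (range (\<lambda>x. p * x) \<inter> range (\<lambda>x. x * p)) Bmp"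
    and Bmm: "relative_basis scale UNIV {p * x + y * p + scale a 1 | x y a. True} Bmm"
    and B: "B = Bpp \<union> Bpm \<union> Bmp \<union> Bmm"
  shows "independent (insert 1 B)" "span (insert 1 B) = UNIV" "1 \<notin> B"
    "span (Bpp \<union> Bmp) = range (\<lambda>x. x * p)" "span (Bpp \<union> Bpm) = range (\<lambda>x. p * x)"
proof -
  let ?R = "range (\<lambda>x. p * x)" and ?L = "range (\<lambda>x. x * p)"
  let ?U = "{p * x + y * p + scale a 1 | x y a. True}"
  have R: "subspace ?R" and L: "subspace ?L"
    by (rule subspace_right_ideal subspace_left_ideal)+
  then have RL: "subspace (?R \<inter> ?L)"
    by (rule subspace_inter)
  have ind_pp: "independent Bpp" and span_pp: "span Bpp = ?R \<inter> ?L"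
    using Bpp by (simp_all add: k_basis_def)
  note pm = relative_basis_independent[OF Bpm RL Int_lower1]
  note mp = relative_basis_independent[OF Bmp RL Int_lower2]
  show span_L: "span (Bpp \<union> Bmp) = ?L"
    by (rule relative_basis_span[OF Bmp L _ span_pp]) simp
  show span_R: "span (Bpp \<union> Bpm) = ?R"
    by (rule relative_basis_span[OF Bpm R _ span_pp]) simp
  have "independent (Bpp \<union> Bmp)"
    using ind_pp mp by (intro independent_Un) (auto simp: span_pp)
  \<comment> \<open>The span of \<open>Bpm\<close> lies in pR, so it can meet Rp only inside pR
    \<inter> Rp, where relative independence leaves only 0.\<close>
  moreover have "span Bpm \<subseteq> ?R"
    using Bpm R by (intro span_minimal) (auto simp: relative_basis_def)
  then have "span (Bpp \<union> Bmp) \<inter> span Bpm \<subseteq> {0}"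
    using pm(2) unfolding span_L by blast
  ultimately have ind3: "independent ((Bpp \<union> Bmp) \<union> Bpm)"
    by (rule independent_Un[OF _ pm(1)])
  have span3: "span ((Bpp \<union> Bmp) \<union> Bpm) = {p * x + y * p | x y. True}"
  proof -
    have "(Bpp \<union> Bmp) \<union> Bpm = (Bpp \<union> Bpm) \<union> (Bpp \<union> Bmp)"
      by auto
    then have "span ((Bpp \<union> Bmp) \<union> Bpm) = {x + y | x y. x \<in> ?R \<and> y \<in> ?L}"
      by (simp only: span_Un[of "Bpp \<union> Bpm" "Bpp \<union> Bmp"] span_L span_R)
    also have "\<dots> = {p * x + y * p | x y. True}"
      by auto
    finally show ?thesis .
  qed
  let ?B3 = "insert 1 ((Bpp \<union> Bmp) \<union> Bpm)"
  \<comment> \<open>The hypothesis that 1 is not in pR + Rp is what allows 1 to be adjoined.\<close>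
  have ind4: "independent ?B3"
    using ind3 one by (intro independent_insertI) (simp_all add: span3)
  have span4: "span ?B3 = ?U"
  proof -
    have "span ?B3 = {x. \<exists>k. x - scale k 1 \<in> {p * x + y * p | x y. True}}"
      by (simp add: span_insert span3)
    also have "\<dots> = ?U"
      by (auto simp: diff_eq_eq)
    finally show ?thesis .
  qed
  then have U: "subspace ?U"
    using subspace_span[of ?B3] by simp
  note mm = relative_basis_independent[OF Bmm U subset_UNIV]
  have eq: "insert 1 B = ?B3 \<union> Bmm"
    by (auto simp: B)
  show "span (insert 1 B) = UNIV"
    unfolding eq by (rule relative_basis_span[OF Bmm subspace_UNIV subset_UNIV span4])
  show "independent (insert 1 B)"
    unfolding eq using ind4 mm by (intro independent_Un) (auto simp: span4)
  have "1 \<notin> (Bpp \<union> Bmp) \<union> Bpm"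
    using one span_superset[of "(Bpp \<union> Bmp) \<union> Bpm"] unfolding span3 by blast
  \<comment> \<open>Otherwise 1 would lie both in the span of \<open>Bmm\<close> and in pR + Rp + k,
    hence be 0.\<close>
  moreover have "1 \<notin> Bmm"
  proof
    assume "1 \<in> Bmm"
    moreover have "1 \<in> ?U"
      using span4 span_base[of 1 ?B3] by auto
    ultimately have "(1 :: 'r) = 0"
      using mm(2) span_base[of 1 Bmm] by blast
    then show False
      by simp
  qed
  ultimately show "1 \<notin> B"
    by (auto simp: B)
qed

end

theorem proposition7:
  fixes scale :: "'k::field \<Rightarrow> 'r::ring_1 \<Rightarrow> 'r"
    and act :: "'m::ab_group_add \<Rightarrow> 'r \<Rightarrow> 'm"
    and p :: 'r
    and Bpp Bpm Bmp Bmm B :: "'r set"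
    and Mplus Cp Cm C :: "'m set"
  assumes "k_algebra scale"
    and "1 \<notin> {p * x + y * p | x y. True}"
    and "k_basis scale (range (\<lambda>x. p * x) \<inter> range (\<lambda>x. x * p)) Bpp"
    and "p \<noteq> 0 \<longrightarrow> p \<in> Bpp"
    and "relative_basis scale (range (\<lambda>x. p * x)) (range (\<lambda>x. p * x) \<inter> range (\<lambda>x. x * p)) Bpm"
    and "relative_basis scale (range (\<lambda>x. x * p)) (range (\<lambda>x. p * x) \<inter> range (\<lambda>x. x * p)) Bmp"
    and "relative_basis scale UNIV {p * x + y * p + scale a 1 | x y a. True} Bmm"
    and "B = Bpp \<union> Bpm \<union> Bmp \<union> Bmm"
    and "p_tempered scale act p Mplus"
    and "k_basis (module_scale scale act) Mplus Cp"
    and "relative_basis (module_scale scale act) UNIV Mplus Cm"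
    and "C = Cp \<union> Cm"
  shows "let
      N = normal_words B (Bpp \<union> Bmp) (Bpp \<union> Bpm) C Cp;
      val = expr_value scale act p Mplus;
      red = expr_reduction scale act p B (Bpp \<union> Bmp) (Bpp \<union> Bpm) C Cp
    in
      inj_on (word_value scale act p Mplus) N \<and>
      tempered_basis scale act p Mplus (word_value scale act p Mplus ` N) \<and>
      (\<forall>w\<in>words B C. \<forall>f.
         word_reduction scale act p B (Bpp \<union> Bmp) (Bpp \<union> Bpm) C Cp w f \<longrightarrow>
         word_value scale act p Mplus w = val f) \<and>
      (\<forall>e :: ('m, 'r, 'k) mexpr. Poly_Mapping.keys e \<subseteq> words B C \<longrightarrow>
         \<not> (\<exists>s. s 0 = e \<and> (\<forall>i. red (s i) (s (Suc i)))) \<and>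
         (\<exists>!g. Poly_Mapping.keys g \<subseteq> N \<and> val g = val e) \<and>
         (\<forall>g. red\<^sup>*\<^sup>* e g \<and> \<not> (\<exists>h. red g h) \<longrightarrow>
            Poly_Mapping.keys g \<subseteq> N \<and> val g = val e))"
proof -
  interpret p_tempered scale act p Mplus by fact
  interpret M: vector_space "module_scale scale act" by (rule vector_space_module)
  note R = algebra_basis[OF assms(2,3,5,6,7,8)]
  have Cp: "M.independent Cp" "M.span Cp = Mplus"
    using assms(10) by (simp_all add: k_basis_def)
  note Cm = M.relative_basis_independent[OF assms(11) Mplus_subspace subset_UNIV]
  have "M.span Cp \<inter> M.span Cm \<subseteq> {0}"
    using Cm(2) unfolding Cp(2) by blast
  then have "M.independent C" "M.span C = UNIV"
    unfolding \<open>C = Cp \<union> Cm\<close>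
    using M.independent_Un[OF Cp(1) Cm(1)]
      M.relative_basis_span[OF assms(11) M.subspace_UNIV subset_UNIV Cp(2)] by simp_all
  then interpret tempered_bases scale act p Mplus B "Bpp \<union> Bmp" "Bpp \<union> Bpm" C Cp
    using R Cp assms(8,12) by unfold_locales auto
  show ?thesis
    unfolding Let_def
  proof (intro conjI ballI allI impI)
    fix e :: "('m, 'r, 'k) mexpr"
    assume e: "Poly_Mapping.keys e \<subseteq> words B C"
    \<comment> \<open>Existence comes from running the reductions to the end, uniqueness from the
      independence of the normal words; confluence is a consequence and not a premise.\<close>
    show "\<exists>!g. Poly_Mapping.keys g \<subseteq> N \<and> val g = val e"
      using normal_form_exists[OF e] val_inj by metis
    show "Poly_Mapping.keys g \<subseteq> N" if "step\<^sup>*\<^sup>* e g \<and> \<not> (\<exists>h. step g h)" for g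
      using that steps_invariant[OF _ e] irreducible_normal by blast
    show "val g = val e" if "step\<^sup>*\<^sup>* e g \<and> \<not> (\<exists>h. step g h)" for g
      using that steps_invariant[OF _ e] by blast
  qed (rule inj_word_value tempered_basis_normal_words val_word_reduction no_infinite_reduction; assumption?)+
qed

end
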